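(* Let $\alpha=\pm1$ and let $V:\mathbb R\to\mathbb R$ be a real smooth $2\pi$-periodic potential. For any $\omega\in\mathbb R$, let $\phi^{\alpha,\omega}$ be the evolution of $[e^{i\omega x}]$ in $\mathscr S'_x(\mathbb R^+_t\times\mathbb R_x,\mathbb C)\cap\mathscr D'_{V,\alpha}(\mathbb R^+_t\times\mathbb R_x,\mathbb C)$, as made explicit by $$\phi^{\alpha,\omega}(t,x)=\sum_{k\in\mathbb Z}e^{-i\alpha k^2t}\Big(\Big(\exp\Big(\int_0^tA_\alpha^\omega(\tau)\,d\tau\Big)\Big)(\delta_0(\kappa))_{\kappa\in\mathbb Z}\Big)_k\,e^{-i\omega^2t}\,e^{-2ik\omega t}\,e^{i(k+\omega)x},$$ and truncated, for $K,M,N\in\mathbb N^*$, as $$\phi^{\alpha,\omega}_{K,M,N}(t,x)=\sum_{k=-K}^Ke^{-i\alpha k^2t}\Big(\Big(\mathrm{Id}+\sum_{n=1}^N\frac{\big(B_\alpha^{\omega,M}(t)\big)^n}{n!}\Big)(\delta_0(\kappa))_{\kappa\in\mathbb Z}\Big)_k\,e^{-i\omega^2t}\,e^{-2ik\omega t}\,e^{i(k+\omega)x}.$$ Then the following two assertions hold for any $\omega\in\mathbb R$. (i) $\displaystyle\lim_{K,M,N\to\infty\ (\text{each of them})}\phi^{\alpha,\omega}_{K,M,N}=\phi^{\alpha,\omega}$ in $\mathscr S'_x(\mathbb R^+_t\times\mathbb R_x,\mathbb C)$, that is, when considered as distributions on $\mathbb R^+_t\times\mathbb S^1$. (ii) For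 any $K,M,N\in\mathbb N^*$, $$\lim_{N'\to+\infty}\sum_{\nu=0}^{N'}\binom{N'}{\nu}\Big(\frac{1+\omega}{2}\Big)^{N'-\nu}\Big(\frac{1-\omega}{2}\Big)^{\nu}\phi^{\alpha,1-2\nu/N'}_{K,M,N}=\phi^{\alpha,\omega}_{K,M,N}\quad\text{in }\mathscr D'(\mathbb R^+_t\times\mathbb R_x,\mathbb C).$$
   Context: $\mathbb N^*$ denotes the set of positive integers. $V(x)=\sum_{k\in\mathbb Z}c_ke^{ikx}$ is the Fourier development of $V$, with $(c_k)_{k\in\mathbb Z}$ rapidly decreasing. The notation $[f]$ is the distribution defined by the function $f$. $\mathscr D'(\mathbb R^+_t\times\mathbb R_x,\mathbb C)$ is the space of distributions on $\mathbb R_t\times\mathbb R_x$ with support in $[0,+\infty[\times\mathbb R$. $\mathscr D'_{V,\alpha}(\mathbb R^+_t\times\mathbb R_x,\mathbb C)$ is the subspace of those $\phi$ which satisfy, in the sense of distributions in $[0,+\infty[_t\times\mathbb R_x$, the equation $\big(i\frac{\partial}{\partial t}+\alpha\frac{\partial^2}{\partial x^2}\big)\phi=V\phi$. $\mathscr S'_x(\mathbb R^+_t\times\mathbb R_x,\mathbb C)$ is the subspace of those which are tempered in $x$: if $\mathbb R_x$ is identified with the circle $\mathbb S^1$ minus a point by stereographic projection, the distribution extends to a distribution on $\mathbb R^+_t\times\mathbb S^1$. A distribution $u\in\mathscr D'(\mathbb R_x,\mathbb C)$ evolves as $\phi\in\mathscr D'_{V,\alpha}(\mathbb R^+_t\times\mathbb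 R_x,\mathbb C)$ if, for every test function $\varphi\in\mathscr D(\mathbb R_x,\mathbb C)$ and every non-negative $\rho\in\mathscr D([0,+\infty[)$ with $\int_0^1\rho(t)\,dt=1$ (so that $\rho(t/\varepsilon)/\varepsilon$ is an approximation of $\delta_0$), $\lim_{\varepsilon\to0^+}\langle\phi(t,x),\varepsilon^{-1}\rho(t/\varepsilon)\varphi(x)\rangle=\langle u,\varphi\rangle$; $\phi$ is then the evolution of $u$. Let $Z$ be the $\mathbb Z\times\mathbb Z$ matrix of the shift $(\gamma_k)_{k\in\mathbb Z}\mapsto(\gamma_{k-1})_{k\in\mathbb Z}$. For $\ell\in\mathbb Z$, $A_{\alpha,\ell}(t)=Z^\ell\cdot\mathrm{Diag}[c_\ell e^{i\alpha\ell(2k-\ell)t};\,k\in\mathbb Z]$, and $A^\omega_\alpha(t)=\sum_{\ell\in\mathbb Z}e^{2i\omega\ell t}A_{\alpha,\ell}(t)$. For $M\in\mathbb N^*$, $$B_\alpha^{\omega,M}(t)=\int_0^t\Big(\sum_{\ell=-M}^Me^{2i\omega\ell\tau}A_{\alpha,\ell}(\tau)\Big)d\tau$$ (Bochner integral of an $\ell^\infty_{\mathbb C}(\mathbb Z^2)$-valued function), powers are matrix powers, and $\exp\big(\int_0^tA_\alpha^\omega(\tau)\,d\tau\big)$ is the limit, as $M,N\to+\infty$, of $\mathrm{Id}+\sum_{n=1}^N\big(B_\alpha^{\omega,M}(t)\big)^n/n!$ in $\ell^\infty_{\mathbb C}(\mathbb Z^2)$. Finally $(\delta_0(\kappa))_{\kappa\in\mathbb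 Z}$ is the column vector with entry $1$ at $\kappa=0$ and $0$ elsewhere, and $(\cdot)_k$ is the $k$-th coordinate.
   Formalization: φ is defined by the explicit series; that it is the evolution of [e^{iωx}] is neither assumed nor proved (it fails for V=0, α=-1, ω≠0). The integral defining B is taken entrywise, since the Bochner integral in ℓ^∞ does not exist for nonconstant V. *)

theory Defs
  imports "HOL-Analysis.Analysis"
begin

section \<open>Smooth functions and distributions\<close>

definition partial_deriv ::
    "'a::euclidean_space \<Rightarrow> ('a \<Rightarrow> 'b::real_normed_vector) \<Rightarrow> 'a \<Rightarrow> 'b" where
  "partial_deriv v f = (\<lambda>z. frechet_derivative f (at z) v)"

text \<open>All iterated partial derivatives are Frechet differentiable, hence also continuous:
  this is class \<open>C\<^sup>\<infinity>\<close>.\<close>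

definition smooth :: "('a::euclidean_space \<Rightarrow> 'b::real_normed_vector) \<Rightarrow> bool" where
  "smooth f \<longleftrightarrow> (\<forall>vs\<in>lists Basis. fold partial_deriv vs f differentiable_on UNIV)"

definition supp :: "('a::euclidean_space \<Rightarrow> complex) \<Rightarrow> 'a set" where
  "supp f = closure {z. f z \<noteq> 0}"

definition Cm_norm :: "nat \<Rightarrow> ('a::euclidean_space \<Rightarrow> complex) \<Rightarrow> real" where
  "Cm_norm m f =
     (\<Sum>vs | set vs \<subseteq> Basis \<and> length vs \<le> m. SUP z. norm (fold partial_deriv vs f z))"

type_synonym 'a functional = "('a \<Rightarrow> complex) \<Rightarrow> complex"

text \<open>Linear forms on a space \<open>D\<close> of test functions that are continuous on each subspace of
  test functions with support in a member of \<open>Ks\<close> (seminorm estimates).  Only the values on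
  \<open>D\<close> are meaningful.\<close>

definition distributions ::
    "('a::euclidean_space \<Rightarrow> complex) set \<Rightarrow> 'a set set \<Rightarrow> 'a functional set" where
  "distributions D Ks = {T.
     (\<forall>f\<in>D. \<forall>g\<in>D. T (\<lambda>z. f z + g z) = T f + T g) \<and>
     (\<forall>c. \<forall>f\<in>D. T (\<lambda>z. c * f z) = c * T f) \<and>
     (\<forall>K\<in>Ks. \<exists>C m. \<forall>f\<in>D. supp f \<subseteq> K \<longrightarrow> norm (T f) \<le> C * Cm_norm m f)}"

definition tests_plane :: "(real \<times> real \<Rightarrow> complex) set" where
  "tests_plane = {f. smooth f \<and> compact (supp f)}"

definition dist_plane :: "(real \<times> real) functional set" where
  "dist_plane = {T \<in> distributions tests_plane {K. compact K}.
     \<forall>f\<in>tests_plane. supp f \<subseteq> {..<0} \<times> UNIV \<longrightarrow> T f = 0}"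

text \<open>A function on \<open>\<real> \<times> S\<^sup>1\<close> is represented by its lift \<open>(t, \<theta>) \<mapsto> f (t, e\<^bsup>i\<theta>\<^esup>)\<close>, which is
  \<open>2\<pi>\<close>-periodic in \<open>\<theta>\<close>.\<close>

definition tests_cylinder :: "(real \<times> real \<Rightarrow> complex) set" where
  "tests_cylinder = {f. smooth f \<and> (\<forall>t \<theta>. f (t, \<theta> + 2 * pi) = f (t, \<theta>)) \<and>
     (\<exists>K. compact K \<and> supp f \<subseteq> K \<times> UNIV)}"

definition dist_cylinder :: "(real \<times> real) functional set" where
  "dist_cylinder = {\<Phi> \<in> distributions tests_cylinder {K \<times> UNIV | K. compact K}.
     \<forall>f\<in>tests_cylinder. supp f \<subseteq> {..<0} \<times> UNIV \<longrightarrow> \<Phi> f = 0}"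

text \<open>Stereographic projection of the unit circle from its point \<open>-1\<close> (\<open>\<theta> = \<pi>\<close>) maps
  \<open>e\<^bsup>i\<theta>\<^esup>\<close> to \<open>x = tan (\<theta>/2)\<close>, with inverse \<open>\<theta> = 2 arctan x\<close>.  Test functions on the circle
  minus this point correspond exactly to test functions on the line.\<close>

definition extends_to_cylinder ::
    "(real \<times> real) functional \<Rightarrow> (real \<times> real) functional \<Rightarrow> bool" where
  "extends_to_cylinder T \<Phi> \<longleftrightarrow>
     (\<forall>f\<in>tests_cylinder. supp f \<inter> (UNIV \<times> {pi}) = {} \<longrightarrow>
        \<Phi> f = T (\<lambda>(t, x). f (t, 2 * arctan x)))"

definition tempered_x :: "(real \<times> real) functional set" where
  "tempered_x = {T \<in> dist_plane. \<exists>\<Phi>\<in>dist_cylinder. extends_to_cylinder T \<Phi>}"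

definition converges_dist_plane ::
    "('i \<Rightarrow> (real \<times> real) functional) \<Rightarrow> (real \<times> real) functional \<Rightarrow> 'i filter \<Rightarrow> bool" where
  "converges_dist_plane T T' F \<longleftrightarrow>
     (\<forall>i. T i \<in> dist_plane) \<and> T' \<in> dist_plane \<and>
     (\<forall>f\<in>tests_plane. ((\<lambda>i. T i f) \<longlongrightarrow> T' f) F)"

text \<open>An extension to the cylinder is unique only up to distributions carried by the point at
  infinity, so convergence on the cylinder means convergence of suitable extensions.\<close>

definition converges_tempered_x ::
    "('i \<Rightarrow> (real \<times> real) functional) \<Rightarrow> (real \<times> real) functional \<Rightarrow> 'i filter \<Rightarrow> bool" where
  "converges_tempered_x T T' F \<longleftrightarrow>
     (\<forall>i. T i \<in> tempered_x) \<and> T' \<in> tempered_x \<and>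
     (\<exists>\<Phi> \<Phi>'. (\<forall>i. \<Phi> i \<in> dist_cylinder \<and> extends_to_cylinder (T i) (\<Phi> i)) \<and>
        \<Phi>' \<in> dist_cylinder \<and> extends_to_cylinder T' \<Phi>' \<and>
        (\<forall>f\<in>tests_cylinder. ((\<lambda>i. \<Phi> i f) \<longlongrightarrow> \<Phi>' f) F))"

text \<open>The distribution defined by a function of \<open>(t, x)\<close> with \<open>t \<ge> 0\<close>, extended by zero to
  negative times.\<close>

definition dist_of_fun :: "(real \<times> real \<Rightarrow> complex) \<Rightarrow> (real \<times> real) functional" where
  "dist_of_fun g f = (LINT z:{0..} \<times> UNIV|lborel. g z * f z)"

section \<open>Infinite matrices\<close>

type_synonym zmat = "int \<Rightarrow> int \<Rightarrow> complex"

definition mat_mult :: "zmat \<Rightarrow> zmat \<Rightarrow> zmat" where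
  "mat_mult X Y = (\<lambda>j k. \<Sum>\<^sub>\<infinity>l. X j l * Y l k)"

definition mat_vec :: "zmat \<Rightarrow> (int \<Rightarrow> complex) \<Rightarrow> int \<Rightarrow> complex" where
  "mat_vec X v = (\<lambda>k. \<Sum>\<^sub>\<infinity>\<kappa>. X k \<kappa> * v \<kappa>)"

definition diag_mat :: "(int \<Rightarrow> complex) \<Rightarrow> zmat" where
  "diag_mat d = (\<lambda>j k. if j = k then d k else 0)"

definition id_mat :: zmat where
  "id_mat = diag_mat (\<lambda>_. 1)"

primrec mat_pow :: "zmat \<Rightarrow> nat \<Rightarrow> zmat" where
  "mat_pow X 0 = id_mat"
| "mat_pow X (Suc n) = mat_mult X (mat_pow X n)"

text \<open>\<open>Z\<^sup>\<ell>\<close> for an integer \<open>\<ell>\<close>, where \<open>Z = Zpow 1\<close> is the matrix of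
  \<open>(\<gamma>\<^sub>k) \<mapsto> (\<gamma>\<^bsub>k-1\<^esub>)\<close>; the lemmas below justify the name.\<close>

definition Zpow :: "int \<Rightarrow> zmat" where
  "Zpow l = (\<lambda>j k. if j = k + l then 1 else 0)"

lemma Zpow_0: "Zpow 0 = id_mat"
  by (auto simp: Zpow_def id_mat_def diag_mat_def fun_eq_iff)

lemma infsum_single_int:
  fixes f :: "int \<Rightarrow> complex"
  assumes "\<And>l. l \<noteq> a \<Longrightarrow> f l = 0"
  shows "(\<Sum>\<^sub>\<infinity>l. f l) = f a"
proof -
  have "(\<Sum>\<^sub>\<infinity>l. f l) = (\<Sum>\<^sub>\<infinity>l\<in>{a}. f l)"
    by (rule infsum_cong_neutral) (use assms in auto)
  then show ?thesis by simp
qed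

lemma Zpow_add: "mat_mult (Zpow l) (Zpow m) = Zpow (l + m)"
proof (intro ext)
  fix j k
  have "mat_mult (Zpow l) (Zpow m) j k = Zpow l j (k + m) * Zpow m (k + m) k"
    unfolding mat_mult_def by (rule infsum_single_int) (simp add: Zpow_def)
  then show "mat_mult (Zpow l) (Zpow m) j k = Zpow (l + m) j k"
    by (simp add: Zpow_def algebra_simps)
qed

lemma Zpow_1_vec: "mat_vec (Zpow 1) v k = v (k - 1)"
proof -
  have "mat_vec (Zpow 1) v k = Zpow 1 k (k - 1) * v (k - 1)"
    unfolding mat_vec_def by (rule infsum_single_int) (simp add: Zpow_def)
  then show ?thesis by (simp add: Zpow_def)
qed

section \<open>The matrices built from the potential\<close>

definition fourier_coeff :: "(real \<Rightarrow> real) \<Rightarrow> int \<Rightarrow> complex" where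
  "fourier_coeff V k = (LINT x:{0..2*pi}|lborel. complex_of_real (V x) * cis (- real_of_int k * x)) / (2 * pi)"

definition A_mat :: "(real \<Rightarrow> real) \<Rightarrow> real \<Rightarrow> int \<Rightarrow> real \<Rightarrow> zmat" where
  "A_mat V \<alpha> l t =
     mat_mult (Zpow l) (diag_mat (\<lambda>k. fourier_coeff V l * cis (\<alpha> * real_of_int (l * (2 * k - l)) * t)))"

text \<open>The integral is taken entry by entry: the frequencies of the entries of \<open>A_mat\<close> are
  unbounded, so in general the integrand is not strongly measurable for the sup norm.\<close>

definition B_mat :: "(real \<Rightarrow> real) \<Rightarrow> real \<Rightarrow> real \<Rightarrow> nat \<Rightarrow> real \<Rightarrow> zmat" where
  "B_mat V \<alpha> \<omega> M t = (\<lambda>j k.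
     LINT \<tau>:{0..t}|lborel. (\<Sum>l = -int M..int M. cis (2 * \<omega> * real_of_int l * \<tau>) * A_mat V \<alpha> l \<tau> j k))"

definition exp_trunc :: "(real \<Rightarrow> real) \<Rightarrow> real \<Rightarrow> real \<Rightarrow> nat \<Rightarrow> nat \<Rightarrow> real \<Rightarrow> zmat" where
  "exp_trunc V \<alpha> \<omega> M N t = (\<lambda>j k.
     id_mat j k + (\<Sum>n = 1..N. mat_pow (B_mat V \<alpha> \<omega> M t) n j k / fact n))"

text \<open>Uniform convergence of the entries is convergence in \<open>\<ell>\<^sup>\<infinity>(\<int>\<^sup>2)\<close>.\<close>

definition exp_int_A :: "(real \<Rightarrow> real) \<Rightarrow> real \<Rightarrow> real \<Rightarrow> real \<Rightarrow> zmat" where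
  "exp_int_A V \<alpha> \<omega> t = (THE E.
     uniform_limit UNIV (\<lambda>(M, N) (j, k). exp_trunc V \<alpha> \<omega> M N t j k) (\<lambda>(j, k). E j k)
       (at_top \<times>\<^sub>F at_top))"

section \<open>The explicit evolution and its truncations\<close>

text \<open>The series \<open>evol\<close> is taken as the definition of the evolution of \<open>e\<^bsup>i\<omega>x\<^esup>\<close>; that it solves
  the Schroedinger equation is neither assumed nor asserted.\<close>

definition delta0 :: "int \<Rightarrow> complex" where
  "delta0 \<kappa> = (if \<kappa> = 0 then 1 else 0)"

definition evol_term :: "real \<Rightarrow> real \<Rightarrow> zmat \<Rightarrow> int \<Rightarrow> real \<Rightarrow> real \<Rightarrow> complex" where
  "evol_term \<alpha> \<omega> E k t x =
     cis (- \<alpha> * (real_of_int k)\<^sup>2 * t) * mat_vec E delta0 k * cis (- \<omega>\<^sup>2 * t)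
       * cis (- 2 * real_of_int k * \<omega> * t) * cis ((real_of_int k + \<omega>) * x)"

definition evol :: "(real \<Rightarrow> real) \<Rightarrow> real \<Rightarrow> real \<Rightarrow> real \<times> real \<Rightarrow> complex" where
  "evol V \<alpha> \<omega> = (\<lambda>(t, x). \<Sum>\<^sub>\<infinity>k. evol_term \<alpha> \<omega> (exp_int_A V \<alpha> \<omega> t) k t x)"

definition evol_trunc ::
    "(real \<Rightarrow> real) \<Rightarrow> real \<Rightarrow> real \<Rightarrow> nat \<Rightarrow> nat \<Rightarrow> nat \<Rightarrow> real \<times> real \<Rightarrow> complex" where
  "evol_trunc V \<alpha> \<omega> K M N = (\<lambda>(t, x).
     \<Sum>k = -int K..int K. evol_term \<alpha> \<omega> (exp_trunc V \<alpha> \<omega> M N t) k t x)"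

end

theory Submission
  imports Defs "HOL-Complex_Analysis.Complex_Analysis" "HOL-Probability.Sinc_Integral"
begin

text \<open>The entries of \<open>B\<close> are bounded by \<open>t \<bar>c\<^bsub>j-k\<^esub>\<bar>\<close>, so its column sums are bounded by
  \<open>t \<Sum>\<bar>c\<^sub>l\<bar>\<close>; the exponential series therefore converges in the norm of operators on
  \<open>\<ell>\<^sup>1\<close>, uniformly on bounded time intervals, and the truncations of \<open>\<phi>\<close> converge uniformly on
  \<open>[0, T] \<times> \<real>\<close>. A function that is bounded on such slabs extends to the cylinder by testing it
  against Taylor remainders at \<open>\<theta> = \<pi>\<close>, which decay like \<open>1 / x\<^sup>2\<close>; the extensions then converge too.
  For the superoscillation, each truncation is an entire function of \<open>\<omega>\<close>, and the sum over \<open>\<nu>\<close> is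
  its Bernstein operator evaluated at a point possibly outside \<open>[-1, 1]\<close>. Bernstein operators
  converge on entire functions at every point, because the moment of order \<open>p\<close> is at most \<open>\<rho>\<^sup>p\<close>
  and converges to the right power; dominated convergence concludes.\<close>

section \<open>Matrices with bounded column sums\<close>

text \<open>The sup norm of the entries, in which the exponential is defined, is not
  submultiplicative: products of bounded matrices need not even converge. The column-sum norm is, it
  dominates the sup norm, and it measures what the evolution uses, namely the absolute sum of column
  0; all phases having modulus 1, x drops out of every estimate. \<open>col_bounded\<close> bounds
  finite partial sums, so that summability of the columns is a consequence and not a side condition.

  The delicate point of the joint limit is the tail in k, uniformly in t. A truncation of the
  exponential is a band matrix, so its column 0 has finite support; beyond it the column of the
  exponential coincides with the error of that truncation, which is already small.

  The column estimates are made at real frequencies, since \<open>exprel\<close> is bounded on the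
  imaginary axis but not on the complex plane. The continuation in \<omega> is therefore made after
  truncation, where each value is a finite expression in entire functions.\<close>

definition col_bounded :: "real \<Rightarrow> zmat \<Rightarrow> bool" where
  "col_bounded s X \<longleftrightarrow> (\<forall>k F. finite F \<longrightarrow> (\<Sum>j\<in>F. norm (X j k)) \<le> s)"

lemma col_boundedD: "col_bounded s X \<Longrightarrow> finite F \<Longrightarrow> (\<Sum>j\<in>F. norm (X j k)) \<le> s"
  by (simp add: col_bounded_def)

lemma col_bounded_entry: "col_bounded s X \<Longrightarrow> norm (X j k) \<le> s"
  using col_boundedD[of s X "{j}" k] by simp

lemma col_bounded_nonneg: "col_bounded s X \<Longrightarrow> 0 \<le> s"
  using col_boundedD[of s X "{}"] by simp

lemma col_bounded_mono: "col_bounded s X \<Longrightarrow> s \<le> u \<Longrightarrow> col_bounded u X"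
  unfolding col_bounded_def by (meson order_trans)

lemma col_bounded_add:
  assumes "col_bounded s X" "col_bounded u Y"
  shows "col_bounded (s + u) (\<lambda>j k. X j k + Y j k)"
  unfolding col_bounded_def
proof (intro allI impI)
  fix k and F :: "int set" assume "finite F"
  have "(\<Sum>j\<in>F. norm (X j k + Y j k)) \<le> (\<Sum>j\<in>F. norm (X j k)) + (\<Sum>j\<in>F. norm (Y j k))"
    unfolding sum.distrib[symmetric] by (intro sum_mono norm_triangle_ineq)
  also have "\<dots> \<le> s + u" using assms \<open>finite F\<close> by (intro add_mono col_boundedD)
  finally show "(\<Sum>j\<in>F. norm (X j k + Y j k)) \<le> s + u" .
qed

lemma col_bounded_zero: "0 \<le> s \<Longrightarrow> col_bounded s (\<lambda>j k. 0)"
  by (simp add: col_bounded_def)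

lemma col_bounded_sum:
  assumes "\<And>n. n \<in> I \<Longrightarrow> col_bounded (s n) (X n)"
  shows "col_bounded (\<Sum>n\<in>I. s n) (\<lambda>j k. \<Sum>n\<in>I. X n j k)"
  using assms
proof (induction I rule: infinite_finite_induct)
  case (insert i I)
  then show ?case
    using col_bounded_add[of "s i" "X i" "sum s I" "\<lambda>j k. \<Sum>n\<in>I. X n j k"] by auto
qed (auto simp: col_bounded_zero)

lemma col_bounded_cmult:
  assumes "col_bounded s X"
  shows "col_bounded (norm c * s) (\<lambda>j k. c * X j k)"
  using assms unfolding col_bounded_def
  by (auto simp: norm_mult mult_left_mono simp flip: sum_distrib_left)

lemma col_bounded_id: "col_bounded 1 id_mat"
  unfolding col_bounded_def id_mat_def diag_mat_def
proof (intro allI impI)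
  fix k :: int and F :: "int set" assume "finite F"
  have "(\<Sum>j\<in>F. norm (if j = k then 1 else 0 :: complex)) = (\<Sum>j\<in>F. if j = k then 1 else 0)"
    by (intro sum.cong) auto
  also have "\<dots> \<le> 1" using \<open>finite F\<close> by (simp add: sum.delta)
  finally show "(\<Sum>j\<in>F. norm (if j = k then 1 else 0 :: complex)) \<le> 1" .
qed

text \<open>Each inequality involves finitely many entries, so entrywise convergence is enough. The
  threshold \<open>n0\<close> serves \<open>col_bounded_exp_diff\<close>, whose estimate starts at
  the truncation index.\<close>

lemma col_bounded_limit:
  assumes "\<And>j k. (\<lambda>n. X n j k) \<longlonglongrightarrow> Y j k"
    and "\<And>n. n \<ge> n0 \<Longrightarrow> col_bounded s (X n)"
  shows "col_bounded s Y"
  unfolding col_bounded_def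
proof (intro allI impI)
  fix k and F :: "int set" assume "finite F"
  have "(\<lambda>n. \<Sum>j\<in>F. norm (X n j k)) \<longlonglongrightarrow> (\<Sum>j\<in>F. norm (Y j k))"
    by (intro tendsto_sum tendsto_norm assms)
  then show "(\<Sum>j\<in>F. norm (Y j k)) \<le> s"
    by (rule LIMSEQ_le_const2) (use assms(2) \<open>finite F\<close> col_boundedD in blast)
qed

lemma col_bounded_summable:
  assumes "col_bounded s X"
  shows "(\<lambda>j. norm (X j k)) summable_on A"
  by (intro nonneg_bdd_above_summable_on bdd_aboveI2[where M = s])
     (use assms in \<open>auto intro: col_boundedD\<close>)

lemma summable_mat_prod:
  assumes "col_bounded s X" "col_bounded u Y"
  shows "(\<lambda>l. norm (X j l * Y l k)) summable_on A"
proof (rule summable_on_comparison_test)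
  show "(\<lambda>l. s * norm (Y l k)) summable_on A"
    by (intro summable_on_cmult_right col_bounded_summable[OF assms(2)])
  show "norm (X j l * Y l k) \<le> s * norm (Y l k)" for l
    using col_bounded_entry[OF assms(1), of j l] by (simp add: norm_mult mult_right_mono)
qed auto

lemma has_sum_sum:
  fixes f :: "'i \<Rightarrow> 'a \<Rightarrow> 'b::real_normed_vector"
  assumes "\<And>i. i \<in> I \<Longrightarrow> f i summable_on A"
  shows "((\<lambda>x. \<Sum>i\<in>I. f i x) has_sum (\<Sum>i\<in>I. infsum (f i) A)) A"
  using assms by (induction I rule: infinite_finite_induct) (auto intro!: has_sum_add)

text \<open>Only a finite sum over j is interchanged with the series over l; the inner column sum of
  X is then at most s for each l.\<close>

lemma col_bounded_mult:
  assumes X: "col_bounded s X" and Y: "col_bounded u Y"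
  shows "col_bounded (s * u) (mat_mult X Y)"
  unfolding col_bounded_def
proof (intro allI impI)
  fix k and F :: "int set" assume F: "finite F"
  have "(\<Sum>j\<in>F. norm (mat_mult X Y j k)) \<le> (\<Sum>j\<in>F. \<Sum>\<^sub>\<infinity>l. norm (X j l * Y l k))"
    unfolding mat_mult_def by (intro sum_mono norm_infsum_bound summable_mat_prod[OF X Y])
  also have "\<dots> = (\<Sum>\<^sub>\<infinity>l. \<Sum>j\<in>F. norm (X j l * Y l k))"
    by (rule infsumI[OF has_sum_sum, symmetric]) (rule summable_mat_prod[OF X Y])
  also have "\<dots> \<le> (\<Sum>\<^sub>\<infinity>l. s * norm (Y l k))"
  proof (rule infsum_mono)
    show "(\<lambda>l. \<Sum>j\<in>F. norm (X j l * Y l k)) summable_on UNIV"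
      by (rule has_sum_imp_summable[OF has_sum_sum]) (rule summable_mat_prod[OF X Y])
    show "(\<lambda>l. s * norm (Y l k)) summable_on UNIV"
      by (intro summable_on_cmult_right col_bounded_summable[OF Y])
    show "(\<Sum>j\<in>F. norm (X j l * Y l k)) \<le> s * norm (Y l k)" for l
      using col_boundedD[OF X F, of l]
      by (simp add: norm_mult mult_right_mono flip: sum_distrib_right)
  qed
  also have "\<dots> = s * (\<Sum>\<^sub>\<infinity>l. norm (Y l k))"
    by (intro infsum_cmult_right col_bounded_summable[OF Y])
  also have "\<dots> \<le> s * u"
    by (intro mult_left_mono infsum_le_finite_sums col_bounded_summable[OF Y]
        col_boundedD[OF Y] col_bounded_nonneg[OF X])
  finally show "(\<Sum>j\<in>F. norm (mat_mult X Y j k)) \<le> s * u" .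
qed

lemma col_bounded_pow:
  assumes "col_bounded s X"
  shows "col_bounded (s ^ n) (mat_pow X n)"
proof (induction n)
  case (Suc n)
  then show ?case using col_bounded_mult[OF assms Suc] by simp
qed (simp add: col_bounded_id)

text \<open>The difference is split through the mixed product of X' and Y, whose series has to
  converge as well; the column bounds supply this.\<close>

lemma mat_mult_diff:
  assumes "col_bounded s X" "col_bounded s' X'" "col_bounded u Y" "col_bounded u' Y'"
  shows "mat_mult X Y j k - mat_mult X' Y' j k =
    mat_mult (\<lambda>j k. X j k - X' j k) Y j k + mat_mult X' (\<lambda>j k. Y j k - Y' j k) j k"
proof -
  have *: "(\<lambda>l. X j l * Y l k) summable_on UNIV" "(\<lambda>l. X' j l * Y' l k) summable_on UNIV"
     "(\<lambda>l. X' j l * Y l k) summable_on UNIV"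
    by (rule Infinite_Sum.abs_summable_summable, rule summable_mat_prod; fact assms)+
  have minus: "infsum f UNIV - infsum g UNIV = (\<Sum>\<^sub>\<infinity>l. f l - g l)"
    if "f summable_on UNIV" "g summable_on UNIV" for f g :: "int \<Rightarrow> complex"
    using infsum_add[OF that(1) summable_on_uminus[THEN iffD2, OF that(2)]] by (simp add: infsum_uminus)
  show ?thesis
    unfolding mat_mult_def left_diff_distrib right_diff_distrib minus[OF *(1,3), symmetric]
      minus[OF *(3,2), symmetric] by simp
qed

text \<open>Telescoping would give d n s^(n-1). The coarser (2 s)^n closes the induction directly
  when s is at least 1, and it still sums to exp (2 s).\<close>

lemma col_bounded_pow_diff:
  assumes X: "col_bounded s X" and Y: "col_bounded s Y"
    and D: "col_bounded d (\<lambda>j k. X j k - Y j k)" and s: "1 \<le> s"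
  shows "col_bounded (d * (2 * s) ^ n) (\<lambda>j k. mat_pow X n j k - mat_pow Y n j k)"
proof (induction n)
  case 0
  then show ?case using col_bounded_nonneg[OF D] by (simp add: col_bounded_zero)
next
  case (Suc n)
  have "col_bounded (d * s ^ n + s * (d * (2 * s) ^ n))
     (\<lambda>j k. mat_pow X (Suc n) j k - mat_pow Y (Suc n) j k)"
    unfolding mat_pow.simps mat_mult_diff[OF X Y col_bounded_pow[OF X] col_bounded_pow[OF Y]]
    by (intro col_bounded_add col_bounded_mult D Y col_bounded_pow[OF X] Suc)
  moreover have "d * s ^ n + s * (d * (2 * s) ^ n) \<le> d * (2 * s) ^ Suc n"
  proof -
    have "s ^ n \<le> (2 * s) ^ n" using s by (intro power_mono) auto
    also have "\<dots> \<le> s * (2 * s) ^ n" using s mult_right_mono[of 1 s "(2 * s) ^ n"] by simp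
    finally have "d * s ^ n \<le> d * (s * (2 * s) ^ n)"
      using col_bounded_nonneg[OF D] by (rule mult_left_mono)
    then show ?thesis by (simp add: algebra_simps)
  qed
  ultimately show ?case by (rule col_bounded_mono)
qed

section \<open>The exponential series of a matrix and its truncations\<close>

definition exp_part :: "zmat \<Rightarrow> nat \<Rightarrow> zmat" where
  "exp_part X N = (\<lambda>j k. \<Sum>n\<le>N. mat_pow X n j k / fact n)"

text \<open>An entrywise series, which \<open>exp_int_A_eq\<close> identifies with the uniform limit
  \<open>exp_int_A\<close>.\<close>

definition mat_exp :: "zmat \<Rightarrow> zmat" where
  "mat_exp X = (\<lambda>j k. \<Sum>n. mat_pow X n j k / fact n)"

lemma exp_part_conv: "exp_part X N j k = id_mat j k + (\<Sum>n = 1..N. mat_pow X n j k / fact n)"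
proof -
  have "{..N} = insert 0 {1..N}" by auto
  then show ?thesis by (simp add: exp_part_def)
qed

lemma exp_sum_le: 
  assumes "0 \<le> (s::real)" "finite I" shows "(\<Sum>n\<in>I. s ^ n / fact n) \<le> exp s"
proof -
  have "(\<lambda>n. s ^ n / fact n) sums exp s"
    using exp_converges[of s] by (simp add: divide_inverse mult.commute)
  then show ?thesis
    using sum_le_suminf[of "\<lambda>n. s ^ n / fact n" I] assms by (simp add: sums_iff)
qed

lemma exp_part_converges:
  assumes X: "col_bounded s X"
  shows "(\<lambda>N. exp_part X N j k) \<longlonglongrightarrow> mat_exp X j k"
proof -
  have "summable (\<lambda>n. mat_pow X n j k / fact n)"
  proof (rule summable_comparison_test')
    show "summable (\<lambda>n. s ^ n / fact n)"
      using summable_exp[of s] by (simp add: divide_inverse mult.commute)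
    show "norm (mat_pow X n j k / fact n) \<le> s ^ n / fact n" for n
      using col_bounded_entry[OF col_bounded_pow[OF X]]
      by (simp add: norm_divide divide_right_mono)
  qed
  then show ?thesis unfolding exp_part_def mat_exp_def by (rule summable_LIMSEQ')
qed

lemma col_bounded_exp_part:
  assumes X: "col_bounded s X"
  shows "col_bounded (exp s) (exp_part X N)"
proof -
  have "col_bounded (\<Sum>n\<le>N. s ^ n / fact n) (exp_part X N)"
    unfolding exp_part_def
  proof (rule col_bounded_sum)
    fix n show "col_bounded (s ^ n / fact n) (\<lambda>j k. mat_pow X n j k / fact n)"
      using col_bounded_cmult[OF col_bounded_pow[OF X], of "1 / fact n" n]
      by (simp add: norm_divide)
  qed
  then show ?thesis
    by (rule col_bounded_mono) (use exp_sum_le col_bounded_nonneg[OF X] in auto)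
qed

text \<open>Two errors add up: replacing X by Y in the terms up to N costs d exp (2 s), and the
  terms beyond N cost the tail of the scalar exponential. Both are estimated for a partial sum N' >=
  N of the first exponential, and N' then tends to infinity.\<close>

lemma col_bounded_exp_diff:
  assumes X: "col_bounded s X" and Y: "col_bounded s Y"
    and D: "col_bounded d (\<lambda>j k. X j k - Y j k)" and s: "1 \<le> s"
  shows "col_bounded (d * exp (2 * s) + (exp s - (\<Sum>n\<le>N. s ^ n / fact n)))
    (\<lambda>j k. mat_exp X j k - exp_part Y N j k)"
proof (rule col_bounded_limit)
  show "(\<lambda>N'. exp_part X N' j k - exp_part Y N j k) \<longlonglongrightarrow> mat_exp X j k - exp_part Y N j k" for j k
    by (intro tendsto_intros exp_part_converges[OF X])
  fix N' assume N': "N \<le> N'"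
  have split: "{..N'} = {..N} \<union> {N<..N'}" using N' by auto
  have 1: "col_bounded (\<Sum>n\<le>N. d * (2 * s) ^ n / fact n)
     (\<lambda>j k. \<Sum>n\<le>N. (mat_pow X n j k - mat_pow Y n j k) / fact n)"
  proof (rule col_bounded_sum)
    fix n show "col_bounded (d * (2 * s) ^ n / fact n)
       (\<lambda>j k. (mat_pow X n j k - mat_pow Y n j k) / fact n)"
      using col_bounded_cmult[OF col_bounded_pow_diff[OF X Y D s], of "1 / fact n" n]
      by (simp add: norm_divide)
  qed
  have 2: "col_bounded (\<Sum>n\<in>{N<..N'}. s ^ n / fact n) (\<lambda>j k. \<Sum>n\<in>{N<..N'}. mat_pow X n j k / fact n)"
  proof (rule col_bounded_sum)
    fix n show "col_bounded (s ^ n / fact n) (\<lambda>j k. mat_pow X n j k / fact n)"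
      using col_bounded_cmult[OF col_bounded_pow[OF X], of "1 / fact n" n]
      by (simp add: norm_divide)
  qed
  have eq: "(\<lambda>j k. exp_part X N' j k - exp_part Y N j k) = (\<lambda>j k. (\<Sum>n\<le>N. (mat_pow X n j k - mat_pow Y n j k) / fact n)
     + (\<Sum>n\<in>{N<..N'}. mat_pow X n j k / fact n))"
    unfolding exp_part_def split
    by (subst sum.union_disjoint) (auto simp: diff_divide_distrib sum_subtractf fun_eq_iff)
  have "(\<Sum>n\<le>N. d * (2 * s) ^ n / fact n) = d * (\<Sum>n\<le>N. (2 * s) ^ n / fact n)"
    by (simp add: sum_distrib_left)
  also have "\<dots> \<le> d * exp (2 * s)"
    using s col_bounded_nonneg[OF D] by (intro mult_left_mono exp_sum_le) auto
  finally have 3: "(\<Sum>n\<le>N. d * (2 * s) ^ n / fact n) \<le> d * exp (2 * s)" .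
  have "(\<Sum>n\<le>N'. s ^ n / fact n) \<le> exp s"
    using s by (intro exp_sum_le) auto
  then have 4: "(\<Sum>n\<in>{N<..N'}. s ^ n / fact n) \<le> exp s - (\<Sum>n\<le>N. s ^ n / fact n)"
    unfolding split by (subst (asm) sum.union_disjoint) auto
  show "col_bounded (d * exp (2 * s) + (exp s - (\<Sum>n\<le>N. s ^ n / fact n))) (\<lambda>j k. exp_part X N' j k - exp_part Y N j k)"
    unfolding eq by (rule col_bounded_mono[OF col_bounded_add[OF 1 2]]) (use 3 4 in linarith)
qed

lemma col_bounded_mat_exp:
  assumes "col_bounded s X"
  shows "col_bounded (exp s) (mat_exp X)"
  using exp_part_converges[OF assms] by (rule col_bounded_limit) (rule col_bounded_exp_part[OF assms])

section \<open>Band matrices\<close>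

definition banded :: "nat \<Rightarrow> zmat \<Rightarrow> bool" where
  "banded m X \<longleftrightarrow> (\<forall>j k. \<bar>j - k\<bar> > int m \<longrightarrow> X j k = 0)"

text \<open>A band turns the matrix product into a finite sum; holomorphy and continuity of the
  powers in frequency and time rest on this.\<close>

lemma banded_mult_entry:
  assumes "banded m X"
  shows "mat_mult X Y j k = (\<Sum>l = j - int m..j + int m. X j l * Y l k)"
proof -
  have "(\<Sum>\<^sub>\<infinity>l. X j l * Y l k) = (\<Sum>\<^sub>\<infinity>l\<in>{j - int m..j + int m}. X j l * Y l k)"
    by (rule infsum_cong_neutral) (use assms in \<open>auto simp: banded_def abs_if\<close>)
  then show ?thesis by (simp add: mat_mult_def)
qed

lemma banded_pow:
  assumes "banded m X"
  shows "banded (n * m) (mat_pow X n)"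
proof (induction n)
  case 0
  then show ?case by (auto simp: banded_def id_mat_def diag_mat_def)
next
  case (Suc n)
  have "X j l = 0 \<or> mat_pow X n l k = 0" if "int (Suc n * m) < \<bar>j - k\<bar>" for j k l
  proof (cases "int m < \<bar>j - l\<bar>")
    case True then show ?thesis using assms by (simp add: banded_def)
  next
    case False
    then have "int (n * m) < \<bar>l - k\<bar>" using that by (simp add: algebra_simps)
    then show ?thesis using Suc by (simp add: banded_def)
  qed
  then show ?case
    unfolding banded_def mat_pow.simps banded_mult_entry[OF assms]
    by (auto intro!: sum.neutral)
qed

text \<open>Column 0 of a truncation vanishes beyond N * M, which is what controls the tail in k of
  the limit.\<close>

lemma banded_exp_part:
  assumes "banded m X"
  shows "banded (N * m) (exp_part X N)"
  unfolding banded_def exp_part_def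
proof (intro allI impI sum.neutral ballI)
  fix j k n assume "int (N * m) < \<bar>j - k\<bar>" "n \<in> {..N}"
  then have "int (n * m) < \<bar>j - k\<bar>"
    by (metis atMost_iff mult_le_mono1 of_nat_mono order_le_less_trans)
  then show "mat_pow X n j k / fact n = 0" using banded_pow[OF assms, of n] by (simp add: banded_def)
qed

lemma mat_vec_delta0: "mat_vec X delta0 k = X k 0"
  unfolding mat_vec_def by (subst infsum_single_int[of 0]) (auto simp: delta0_def)

section \<open>Smooth functions\<close>

lemma smooth_fold_differentiable:
  assumes "smooth f" "set vs \<subseteq> Basis"
  shows "fold partial_deriv vs f differentiable at z"
  using assms unfolding smooth_def by (auto simp: lists_eq_set differentiable_on_def)

lemma smooth_differentiable: "smooth f \<Longrightarrow> f differentiable at z"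
  using smooth_fold_differentiable[of f "[]"] by simp

lemma smooth_partial_deriv:
  assumes "smooth f" "v \<in> Basis"
  shows "smooth (partial_deriv v f)"
  unfolding smooth_def
proof
  fix vs :: "'a list" assume "vs \<in> lists Basis"
  then have "v # vs \<in> lists Basis" using assms by auto
  then have "fold partial_deriv (v # vs) f differentiable_on UNIV"
    using assms unfolding smooth_def by blast
  then show "fold partial_deriv vs (partial_deriv v f) differentiable_on UNIV" by simp
qed

lemma smooth_continuous_on: "smooth f \<Longrightarrow> continuous_on A f"
  by (intro continuous_at_imp_continuous_on ballI differentiable_imp_continuous_within
      smooth_differentiable)

lemma smooth_has_vector_derivative:
  fixes f :: "real \<Rightarrow> real"
  assumes "smooth f"
  shows "(f has_vector_derivative partial_deriv 1 f x) (at x)"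
proof -
  have "(f has_derivative frechet_derivative f (at x)) (at x)"
    using smooth_differentiable[OF assms] frechet_derivative_works by blast
  moreover have "frechet_derivative f (at x) y = y *\<^sub>R partial_deriv 1 f x" for y
    using linear_scale[OF has_derivative_linear[OF calculation], of y 1] by (simp add: partial_deriv_def)
  then have "frechet_derivative f (at x) = (\<lambda>y. y *\<^sub>R partial_deriv 1 f x)" by (rule ext)
  ultimately show ?thesis unfolding has_vector_derivative_def by simp
qed

section \<open>Summability of the Fourier coefficients\<close>

lemma has_vector_derivative_cis:
  "((\<lambda>x. cis (a * x)) has_vector_derivative \<i> * of_real a * cis (a * x)) (at x within S)"
proof -
  have "((\<lambda>x. exp (\<i> * (of_real a * x))) has_field_derivative \<i> * of_real a * exp (\<i> * (of_real a * of_real x)))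
     (at (of_real x))"
    by (auto intro!: derivative_eq_intros)
  from has_vector_derivative_real_field[OF this] show ?thesis
    by (simp add: cis_conv_exp algebra_simps)
qed

lemma summable_on_inverse_square_int: "(\<lambda>k::int. 1 / (real_of_int k)\<^sup>2) summable_on UNIV"
proof -
  have "summable (\<lambda>n. 1 / (real n)\<^sup>2)"
    using inverse_power_summable[of 2, where 'a = real] by (simp add: field_simps)
  then have *: "(\<lambda>n. 1 / (real n)\<^sup>2) summable_on UNIV"
    by (intro summable_nonneg_imp_summable_on) auto
  have "(\<lambda>k::int. 1 / (real_of_int k)\<^sup>2) summable_on range int"
    by (subst summable_on_reindex) (use * in \<open>auto simp: o_def\<close>)
  moreover have "(\<lambda>k::int. 1 / (real_of_int k)\<^sup>2) summable_on range (\<lambda>n. - int n)"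
    by (subst summable_on_reindex) (use * in \<open>auto simp: o_def inj_def\<close>)
  ultimately have "(\<lambda>k::int. 1 / (real_of_int k)\<^sup>2) summable_on (range int \<union> range (\<lambda>n. - int n))"
    by (rule summable_on_union)
  moreover have "range int \<union> range (\<lambda>n. - int n) = UNIV"
    by (auto simp: image_iff) (metis int_cases2)
  ultimately show ?thesis by simp
qed

text \<open>Two integrations by parts against e^(-ikx): periodicity of V and V' cancels the boundary
  terms, and the integral of V'' remains.\<close>

lemma fourier_coeff_decay:
  assumes V: "smooth V" and per: "\<And>x. V (x + 2 * pi) = V x"
  obtains C where "\<And>k. k \<noteq> 0 \<Longrightarrow> norm (fourier_coeff V k) \<le> C / (real_of_int k)\<^sup>2"
proof -
  define V1 where "V1 = partial_deriv 1 V"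
  define V2 where "V2 = partial_deriv 1 V1"
  have sm: "smooth V1" "smooth V2"
    unfolding V1_def V2_def by (auto intro!: smooth_partial_deriv V)
  \<comment> \<open>V composed with the shift is V again, so its derivative at 0 is both
    \<open>V1 (2 * pi)\<close> and \<open>V1 0\<close>.\<close>
  have per1: "V1 (2 * pi) = V1 0"
  proof -
    have "(V has_vector_derivative V1 (2 * pi)) (at (0 + 2 * pi))"
      unfolding V1_def using smooth_has_vector_derivative[OF V, of "2 * pi"] by simp
    then have "((V \<circ> (\<lambda>x. x + 2 * pi)) has_vector_derivative V1 (2 * pi)) (at 0)"
      using vector_diff_chain_at[of "\<lambda>x. x + 2 * pi" 1 0 V "V1 (2 * pi)"]
      by (simp add: has_vector_derivative_def has_derivative_add_const)
    moreover have "V \<circ> (\<lambda>x. x + 2 * pi) = V" using per by auto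
    ultimately show ?thesis
      using smooth_has_vector_derivative[OF V, of 0] vector_derivative_unique_at
      unfolding V1_def by metis
  qed
  obtain B where B: "\<And>x. x \<in> {0..2*pi} \<Longrightarrow> norm (V2 x) \<le> B"
    using compact_imp_bounded[OF compact_continuous_image[OF smooth_continuous_on[OF sm(2)] compact_Icc]]
    unfolding bounded_iff by blast
  have "norm (fourier_coeff V k) \<le> B / (real_of_int k)\<^sup>2" if "k \<noteq> 0" for k
  proof -
    define e where "e = (\<lambda>x. cis (- real_of_int k * x))"
    define k' where "k' = complex_of_real (real_of_int k)"
    have k': "k' \<noteq> 0" using that by (simp add: k'_def)
    have e: "(e has_vector_derivative - \<i> * k' * e x) (at x within S)" for x S
      unfolding e_def k'_def using has_vector_derivative_cis[of "- real_of_int k" x S] by simp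
    have c: "continuous_on S e" for S
      unfolding e_def by (intro continuous_intros)
    have d: "((\<lambda>x. complex_of_real (f x)) has_vector_derivative of_real (partial_deriv 1 f x)) (at x within S)"
      if "smooth f" for f x S
      using has_vector_derivative_at_within[OF smooth_has_vector_derivative[OF that]]
      by (auto intro!: has_vector_derivative_of_real simp: has_real_derivative_iff_has_vector_derivative)
    define I where "I = (\<lambda>f. LINT x:{0..2*pi}|lborel. complex_of_real (f x) * e x)"
    have int: "set_integrable lborel {0..2*pi} (\<lambda>x. complex_of_real (f x) * e x)"
      if "smooth f" for f
      by (intro borel_integrable_atLeastAtMost' continuous_intros c smooth_continuous_on[OF that])
    define U U1 U2 where "U = (\<lambda>x. complex_of_real (V x))" and "U1 = (\<lambda>x. complex_of_real (V1 x))"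
      and "U2 = (\<lambda>x. complex_of_real (V2 x))"
    have U: "(U has_vector_derivative U1 x) (at x within S)" "(U1 has_vector_derivative U2 x) (at x within S)" for x S
      unfolding U_def U1_def U2_def V2_def using d[OF V] d[OF sm(1)] by (auto simp: V1_def)
    \<comment> \<open>An antiderivative that carries out both integrations by parts at once: the two
      \<open>U1\<close> terms of its derivative cancel.\<close>
    define G where "G = (\<lambda>x. \<i> / k' * (U x * e x) + 1 / k'\<^sup>2 * (U1 x * e x))"
    have G: "(G has_vector_derivative of_real (V x) * e x + 1 / k'\<^sup>2 * (of_real (V2 x) * e x)) (at x within S)" for x S
    proof -
      have "(G has_vector_derivative \<i> / k' * (U x * (- \<i> * k' * e x) + U1 x * e x)
         + 1 / k'\<^sup>2 * (U1 x * (- \<i> * k' * e x) + U2 x * e x)) (at x within S)"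
        unfolding G_def by (intro has_vector_derivative_add has_vector_derivative_mult_right has_vector_derivative_mult U e)
      moreover have "\<i> / k' * (U x * (- \<i> * k' * e x) + U1 x * e x)
         + 1 / k'\<^sup>2 * (U1 x * (- \<i> * k' * e x) + U2 x * e x) = U x * e x + 1 / k'\<^sup>2 * (U2 x * e x)"
        using k' by (simp add: field_simps power2_eq_square)
      ultimately show ?thesis by (simp add: U_def U2_def)
    qed
    have "G (2 * pi) = G 0"
    proof -
      have "V (2 * pi) = V 0" using per[of 0] by simp
      moreover have "e (2 * pi) = 1" "e 0 = 1"
        using cis_multiple_2pi[of "- real_of_int k"] by (simp_all add: e_def algebra_simps)
      ultimately show ?thesis by (simp add: G_def per1 U_def U1_def)
    qed
    moreover have "(LINT x:{0..2*pi}|lborel. of_real (V x) * e x + 1 / k'\<^sup>2 * (of_real (V2 x) * e x)) = G (2 * pi) - G 0"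
      unfolding set_lebesgue_integral_def using G
      by (intro integral_FTC_atLeastAtMost continuous_intros c smooth_continuous_on V sm) auto
    moreover have "(LINT x:{0..2*pi}|lborel. of_real (V x) * e x + 1 / k'\<^sup>2 * (of_real (V2 x) * e x))
        = I V + 1 / k'\<^sup>2 * I V2"
      unfolding I_def using int[OF V] int[OF sm(2)]
      by (subst set_integral_add) auto
    ultimately have IV: "I V = - (1 / k'\<^sup>2 * I V2)" by (simp add: eq_neg_iff_add_eq_0)
    have "I V2 = integral {0..2*pi} (\<lambda>x. of_real (V2 x) * e x)"
      unfolding I_def by (rule set_borel_integral_eq_integral(2)[OF int[OF sm(2)]])
    also have "norm \<dots> \<le> B * (2 * pi - 0)"
      by (rule integral_bound)
        (auto simp: norm_mult e_def B[simplified] intro!: continuous_intros smooth_continuous_on[OF sm(2)])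
    finally have I2: "norm (I V2) \<le> B * (2 * pi)" by simp
    have "fourier_coeff V k = I V / (2 * pi)"
      unfolding fourier_coeff_def I_def e_def by simp
    then have "norm (fourier_coeff V k) = norm (I V2) / (2 * pi) / (real_of_int k)\<^sup>2"
      by (simp add: IV norm_mult norm_divide norm_power k'_def)
    also have "\<dots> \<le> B / (real_of_int k)\<^sup>2"
      using I2 by (intro divide_right_mono) (auto simp: field_simps)
    finally show ?thesis .
  qed
  then show ?thesis using that by blast
qed

lemma fourier_coeff_summable:
  assumes V: "smooth V" and per: "\<And>x. V (x + 2 * pi) = V x"
  shows "(\<lambda>k. norm (fourier_coeff V k)) summable_on UNIV"
proof -
  obtain C where C: "\<And>k. k \<noteq> 0 \<Longrightarrow> norm (fourier_coeff V k) \<le> C / (real_of_int k)\<^sup>2"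
    using fourier_coeff_decay[OF assms] by blast
  have "(\<lambda>k. norm (fourier_coeff V k)) summable_on (- {0})"
  proof (rule summable_on_comparison_test)
    show "(\<lambda>k. C * (1 / (real_of_int k)\<^sup>2)) summable_on (- {0})"
      by (intro summable_on_cmult_right summable_on_subset_banach[OF summable_on_inverse_square_int]) auto
    show "norm (fourier_coeff V k) \<le> C * (1 / (real_of_int k)\<^sup>2)" if "k \<in> - {0}" for k
      using C[of k] that by simp
  qed auto
  then have "(\<lambda>k. norm (fourier_coeff V k)) summable_on ({0} \<union> - {0})"
    by (intro summable_on_union) auto
  then show ?thesis by (metis Compl_partition)
qed

section \<open>The matrices of the evolution\<close>

text \<open>With the removable singularity filled in, t * exprel (i b t) is the integral of e^(i b
  \<tau>) over [0, t] also at b = 0, and it is entire in b.\<close>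

definition exprel :: "complex \<Rightarrow> complex" where
  "exprel z = (if z = 0 then 1 else (exp z - 1) / z)"

text \<open>It is the difference quotient of exp at 0, completed by the derivative.\<close>

lemma exprel_holomorphic: "exprel holomorphic_on UNIV"
proof -
  have "deriv exp (0::complex) = 1" by (simp add: DERIV_imp_deriv DERIV_exp[of 0, simplified])
  then have "(\<lambda>z. if z = 0 then deriv exp 0 else (exp z - exp 0) / (z - 0)) = exprel"
    by (auto simp: exprel_def fun_eq_iff)
  then show ?thesis
    using pole_lemma[of exp UNIV 0] holomorphic_on_exp by simp
qed

lemma exprel_holomorphic_comp [holomorphic_intros]:
  "f holomorphic_on S \<Longrightarrow> (\<lambda>x. exprel (f x)) holomorphic_on S"
  using holomorphic_on_compose_gen[OF _ exprel_holomorphic] by (auto simp: o_def)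

lemma continuous_on_exprel [continuous_intros]:
  fixes f :: "'a::topological_space \<Rightarrow> complex"
  assumes "continuous_on S f"
  shows "continuous_on S (\<lambda>x. exprel (f x))"
  using continuous_on_compose2[OF holomorphic_on_imp_continuous_on[OF exprel_holomorphic] assms]
  by auto

text \<open>A chord of the unit circle is no longer than its arc. The bound does not see the
  frequency, which is unbounded in the matrix entries.\<close>

lemma norm_exprel_le: "norm (exprel (\<i> * of_real b)) \<le> 1"
proof (cases "b = 0")
  case False
  have "norm (exp (\<i> * of_real b) - 1) \<le> \<bar>b\<bar>"
    unfolding dist_exp_i_1 using abs_sin_x_le_abs_x[of "b / 2"] by simp
  then show ?thesis using False
    by (simp add: exprel_def norm_divide norm_mult field_simps)
qed (simp add: exprel_def)

lemma integral_cis: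
  assumes "0 \<le> t"
  shows "(LINT \<tau>:{0..t}|lborel. cis (b * \<tau>)) = of_real t * exprel (\<i> * of_real (b * t))"
proof (cases "b = 0")
  case True
  then show ?thesis using assms by (simp add: set_lebesgue_integral_def scaleR_conv_of_real exprel_def)
next
  case False
  have "(LINT \<tau>:{0..t}|lborel. cis (b * \<tau>)) = cis (b * t) / (\<i> * b) - cis (b * 0) / (\<i> * b)"
    unfolding set_lebesgue_integral_def
    using assms False has_vector_derivative_cis[of b]
    by (intro integral_FTC_atLeastAtMost continuous_intros)
      (auto intro!: derivative_eq_intros)
  also have "\<dots> = of_real t * exprel (\<i> * of_real (b * t))"
    using False by (auto simp: exprel_def cis_conv_exp field_simps)
  finally show ?thesis .
qed

text \<open>The frequency \<open>w\<close> is complex in view of the analytic continuation in \<open>\<omega>\<close>;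
  \<open>max 0 t\<close> accounts for the empty interval of integration at negative times.\<close>

definition B_entry :: "(real \<Rightarrow> real) \<Rightarrow> real \<Rightarrow> complex \<Rightarrow> real \<Rightarrow> zmat" where
  "B_entry V \<alpha> w t = (\<lambda>j k. fourier_coeff V (j - k) * (of_real (max 0 t) *
     exprel (\<i> * ((2 * w * of_int (j - k) + of_real (\<alpha> * of_int ((j - k) * (2 * k - (j - k))))) * of_real (max 0 t)))))"

definition band_part :: "nat \<Rightarrow> zmat \<Rightarrow> zmat" where
  "band_part M X = (\<lambda>j k. if \<bar>j - k\<bar> \<le> int M then X j k else 0)"

lemma banded_band_part: "banded M (band_part M X)"
  by (simp add: banded_def band_part_def)

lemma A_mat_entry:
  "A_mat V \<alpha> l t j k =
     (if j = k + l then fourier_coeff V l * cis (\<alpha> * real_of_int (l * (2 * k - l)) * t) else 0)"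
  unfolding A_mat_def mat_mult_def
  by (subst infsum_single_int[of k]) (auto simp: diag_mat_def Zpow_def)

text \<open>At the entry (j, k) only the summand l = j - k is nonzero, so truncating the sum at M
  amounts to keeping a band. At negative times both sides vanish: the interval is empty and
  \<open>max 0 t\<close> is 0.\<close>

lemma B_mat_eq: "B_mat V \<alpha> \<omega> M t = band_part M (B_entry V \<alpha> (of_real \<omega>) t)"
proof (intro ext)
  fix j k
  define b where "b = 2 * \<omega> * of_int (j - k) + \<alpha> * of_int ((j - k) * (2 * k - (j - k)))"
  have integrand: "(\<Sum>l = -int M..int M. cis (2 * \<omega> * real_of_int l * \<tau>) * A_mat V \<alpha> l \<tau> j k)
     = (if \<bar>j - k\<bar> \<le> int M then fourier_coeff V (j - k) * cis (b * \<tau>) else 0)" for \<tau>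
  proof -
    have "(\<Sum>l = -int M..int M. cis (2 * \<omega> * real_of_int l * \<tau>) * A_mat V \<alpha> l \<tau> j k)
      = (\<Sum>l = -int M..int M. if l = j - k then fourier_coeff V (j - k) * cis (b * \<tau>) else 0)"
      by (intro sum.cong refl)
        (auto simp: A_mat_entry b_def cis_mult algebra_simps)
    then show ?thesis by (auto simp: sum.delta)
  qed
  show "B_mat V \<alpha> \<omega> M t j k = band_part M (B_entry V \<alpha> (of_real \<omega>) t) j k"
  proof (cases "0 \<le> t")
    case True
    then have "max 0 t = t" by simp
    moreover have "\<i> * of_real (b * t) = \<i> * ((2 * of_real \<omega> * of_int (j - k) + of_real (\<alpha> * of_int ((j - k) * (2 * k - (j - k))))) * of_real t)"
      by (simp add: b_def)
    ultimately have "(LINT \<tau>:{0..t}|lborel. fourier_coeff V (j - k) * cis (b * \<tau>)) = B_entry V \<alpha> (of_real \<omega>) t j k"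
      unfolding B_entry_def set_integral_mult_right integral_cis[OF True] by metis
    then show ?thesis
      unfolding B_mat_def integrand band_part_def
      by (cases "\<bar>j - k\<bar> \<le> int M") (simp_all add: set_lebesgue_integral_def)
  next
    case False
    then show ?thesis
      by (simp add: B_mat_def integrand band_part_def B_entry_def set_lebesgue_integral_def)
  qed
qed

lemma exp_trunc_eq: "exp_trunc V \<alpha> \<omega> M N t = exp_part (band_part M (B_entry V \<alpha> (of_real \<omega>) t)) N"
  unfolding exp_trunc_def B_mat_eq by (intro ext) (simp add: exp_part_conv)

lemma norm_B_entry_le:
  "norm (B_entry V \<alpha> (of_real \<omega>) t j k) \<le> norm (fourier_coeff V (j - k)) * max 0 t"
proof -
  define b where "b = (2 * \<omega> * of_int (j - k) + \<alpha> * of_int ((j - k) * (2 * k - (j - k)))) * max 0 t"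
  have *: "\<i> * ((2 * of_real \<omega> * of_int (j - k) + of_real (\<alpha> * of_int ((j - k) * (2 * k - (j - k))))) * of_real (max 0 t))
     = \<i> * complex_of_real b"
    by (simp add: b_def)
  have "max 0 t * norm (exprel (\<i> * of_real b)) \<le> max 0 t * 1"
    by (intro mult_left_mono norm_exprel_le) auto
  then show ?thesis unfolding B_entry_def * norm_mult
    by (intro mult_left_mono) auto
qed

text \<open>The mass of the Fourier coefficients beyond M. Times T, it bounds the column norm of
  what the band discards at times up to T.\<close>

definition coeff_tail :: "(real \<Rightarrow> real) \<Rightarrow> nat \<Rightarrow> real" where
  "coeff_tail V M = (\<Sum>\<^sub>\<infinity>l. norm (fourier_coeff V l)) - (\<Sum>l\<in>{-int M..int M}. norm (fourier_coeff V l))"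

lemma col_bounded_band_part: "col_bounded s X \<Longrightarrow> col_bounded s (band_part M X)"
  unfolding col_bounded_def band_part_def
  by (smt (verit, best) norm_ge_zero norm_zero sum_mono)

context
  fixes V :: "real \<Rightarrow> real"
  assumes c_summable: "(\<lambda>l. norm (fourier_coeff V l)) summable_on UNIV"
begin

lemma sum_fourier_le: 
  "finite F \<Longrightarrow> (\<Sum>l\<in>F. norm (fourier_coeff V l)) \<le> (\<Sum>\<^sub>\<infinity>l. norm (fourier_coeff V l))"
  by (rule finite_sum_le_infsum[OF c_summable]) auto

text \<open>The symmetric intervals eventually contain any finite set, so the unordered sum is also
  their limit.\<close>

lemma coeff_tail_tendsto: "coeff_tail V \<longlonglongrightarrow> 0"
proof -
  have "(sum (\<lambda>l. norm (fourier_coeff V l)) \<longlongrightarrow> (\<Sum>\<^sub>\<infinity>l. norm (fourier_coeff V l))) (finite_subsets_at_top UNIV)"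
    using c_summable infsum_tendsto by blast
  moreover have "filterlim (\<lambda>M. {-int M..int M}) (finite_subsets_at_top UNIV) sequentially"
    unfolding filterlim_finite_subsets_at_top
  proof safe
    fix X :: "int set" assume "finite X"
    then obtain m where m: "\<And>x. x \<in> X \<Longrightarrow> nat \<bar>x\<bar> \<le> m"
      using finite_imageI[of X "\<lambda>x. nat \<bar>x\<bar>"] by (metis finite_nat_set_iff_bounded_le imageI)
    show "\<forall>\<^sub>F M in sequentially. finite {-int M..int M} \<and> X \<subseteq> {-int M..int M} \<and> {-int M..int M} \<subseteq> UNIV"
      using eventually_ge_at_top[of m] by eventually_elim (use m in force)
  qed
  ultimately have "(\<lambda>M. \<Sum>l\<in>{-int M..int M}. norm (fourier_coeff V l)) \<longlonglongrightarrow> (\<Sum>\<^sub>\<infinity>l. norm (fourier_coeff V l))"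
    by (rule filterlim_compose)
  then show ?thesis
    unfolding coeff_tail_def[abs_def] by (auto intro!: tendsto_eq_intros)
qed

lemma sum_fourier_tail_le:
  assumes "finite F"
  shows "(\<Sum>l\<in>F - {-int M..int M}. norm (fourier_coeff V l)) \<le> coeff_tail V M"
proof -
  have "(\<Sum>l\<in>F - {-int M..int M}. norm (fourier_coeff V l)) + (\<Sum>l\<in>{-int M..int M}. norm (fourier_coeff V l))
    = (\<Sum>l\<in>(F - {-int M..int M}) \<union> {-int M..int M}. norm (fourier_coeff V l))"
    using assms by (intro sum.union_disjoint[symmetric]) auto
  also have "\<dots> \<le> (\<Sum>\<^sub>\<infinity>l. norm (fourier_coeff V l))"
    using assms by (intro sum_fourier_le) auto
  finally show ?thesis by (simp add: coeff_tail_def)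
qed

text \<open>Column k is dominated by t times the coefficients translated by k, and translation is
  injective. T replaces t in the bound to make it uniform on a time interval.\<close>

lemma col_bounded_B_entry:
  assumes "max 0 t \<le> T"
  shows "col_bounded ((\<Sum>\<^sub>\<infinity>l. norm (fourier_coeff V l)) * T) (B_entry V \<alpha> (of_real \<omega>) t)"
  unfolding col_bounded_def
proof (intro allI impI)
  fix k :: int and F :: "int set" assume F: "finite F"
  have "(\<Sum>j\<in>F. norm (B_entry V \<alpha> (of_real \<omega>) t j k)) \<le> (\<Sum>j\<in>F. norm (fourier_coeff V (j - k)) * max 0 t)"
    by (intro sum_mono norm_B_entry_le)
  also have "\<dots> = (\<Sum>l\<in>(\<lambda>j. j - k) ` F. norm (fourier_coeff V l)) * max 0 t"
    by (subst sum.reindex) (auto simp: sum_distrib_right inj_on_def)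
  also have "\<dots> \<le> (\<Sum>\<^sub>\<infinity>l. norm (fourier_coeff V l)) * T"
    using F assms by (intro mult_mono sum_fourier_le infsum_nonneg) auto
  finally show "(\<Sum>j\<in>F. norm (B_entry V \<alpha> (of_real \<omega>) t j k)) \<le> (\<Sum>\<^sub>\<infinity>l. norm (fourier_coeff V l)) * T" .
qed

lemma col_bounded_band_diff:
  assumes "max 0 t \<le> T"
  shows "col_bounded (coeff_tail V M * T)
     (\<lambda>j k. B_entry V \<alpha> (of_real \<omega>) t j k - band_part M (B_entry V \<alpha> (of_real \<omega>) t) j k)"
  unfolding col_bounded_def
proof (intro allI impI)
  fix k :: int and F :: "int set" assume F: "finite F"
  let ?G = "F - {k - int M..k + int M}"
  have "(\<Sum>j\<in>F. norm (B_entry V \<alpha> (of_real \<omega>) t j k - band_part M (B_entry V \<alpha> (of_real \<omega>) t) j k))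
     = (\<Sum>j\<in>?G. norm (B_entry V \<alpha> (of_real \<omega>) t j k))"
    using F by (intro sum.mono_neutral_cong_right) (auto simp: band_part_def)
  also have "\<dots> \<le> (\<Sum>j\<in>?G. norm (fourier_coeff V (j - k)) * max 0 t)"
    by (intro sum_mono norm_B_entry_le)
  also have "\<dots> = (\<Sum>l\<in>(\<lambda>j. j - k) ` ?G. norm (fourier_coeff V l)) * max 0 t"
    by (subst sum.reindex) (auto simp: sum_distrib_right inj_on_def)
  also have "(\<lambda>j. j - k) ` ?G = (\<lambda>j. j - k) ` F - {-int M..int M}"
    by (force simp: image_iff)
  \<comment> \<open>The instance of \<open>sum_fourier_tail_le\<close> at the empty set supplies the
    nonnegativity of \<open>coeff_tail V M\<close>.\<close>
  also have "(\<Sum>l\<in>(\<lambda>j. j - k) ` F - {-int M..int M}. norm (fourier_coeff V l)) * max 0 t \<le> coeff_tail V M * T"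
    using F assms sum_fourier_tail_le[of "{}" M] by (intro mult_mono sum_fourier_tail_le) auto
  finally show "(\<Sum>j\<in>F. norm (B_entry V \<alpha> (of_real \<omega>) t j k - band_part M (B_entry V \<alpha> (of_real \<omega>) t) j k)) \<le> coeff_tail V M * T" .
qed

end

section \<open>Bernstein operators on entire functions\<close>

text \<open>For y + z = 1 and g \<nu> = f (\<nu> / n) this is the Bernstein polynomial of f at z.
  Outside [0, 1] the weights are no longer probabilities, so the moments are treated
  algebraically.\<close>

definition bern_sum :: "complex \<Rightarrow> complex \<Rightarrow> nat \<Rightarrow> (nat \<Rightarrow> complex) \<Rightarrow> complex" where
  "bern_sum y z n g = (\<Sum>\<nu>\<le>n. of_nat (n choose \<nu>) * y ^ (n - \<nu>) * z ^ \<nu> * g \<nu>)"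

text \<open>Absorption: the factor \<nu> lowers both arguments of the binomial coefficient and
  brings out n + 1.\<close>

lemma bern_sum_shift:
  "bern_sum y z (Suc n) (\<lambda>\<nu>. of_nat \<nu> * g \<nu>) = of_nat (Suc n) * z * bern_sum y z n (\<lambda>\<nu>. g (Suc \<nu>))"
proof -
  have "bern_sum y z (Suc n) (\<lambda>\<nu>. of_nat \<nu> * g \<nu>)
    = (\<Sum>\<nu>\<le>n. of_nat (Suc n choose Suc \<nu>) * y ^ (n - \<nu>) * z ^ Suc \<nu> * (of_nat (Suc \<nu>) * g (Suc \<nu>)))"
    unfolding bern_sum_def by (subst sum.atMost_Suc_shift) simp
  also have "\<dots> = (\<Sum>\<nu>\<le>n. of_nat (Suc n) * z * (of_nat (n choose \<nu>) * y ^ (n - \<nu>) * z ^ \<nu> * g (Suc \<nu>)))"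
  proof (rule sum.cong)
    fix \<nu>
    have "of_nat (Suc n choose Suc \<nu>) * of_nat (Suc \<nu>) = (of_nat (Suc n) * of_nat (n choose \<nu>) :: complex)"
      unfolding of_nat_mult[symmetric] by (metis Suc_times_binomial_eq)
    moreover have "of_nat (Suc n choose Suc \<nu>) * y ^ (n - \<nu>) * z ^ Suc \<nu> * (of_nat (Suc \<nu>) * g (Suc \<nu>))
      = (of_nat (Suc n choose Suc \<nu>) * of_nat (Suc \<nu>)) * (y ^ (n - \<nu>) * z * z ^ \<nu> * g (Suc \<nu>))"
      by (simp only: power_Suc mult_ac)
    ultimately show "of_nat (Suc n choose Suc \<nu>) * y ^ (n - \<nu>) * z ^ Suc \<nu> * (of_nat (Suc \<nu>) * g (Suc \<nu>))
      = of_nat (Suc n) * z * (of_nat (n choose \<nu>) * y ^ (n - \<nu>) * z ^ \<nu> * g (Suc \<nu>))"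
      by (simp only: mult_ac)
  qed simp
  finally show ?thesis by (simp only: bern_sum_def sum_distrib_left)
qed

text \<open>After the shift, expanding (\<nu> + 1)^p reduces a moment of order p + 1 to moments of
  order at most p, with n lowered by one; the bound and the limit of the moments both follow by
  strong induction on the order.\<close>

lemma bern_sum_moment_rec:
  "bern_sum y z (Suc n) (\<lambda>\<nu>. of_nat \<nu> ^ Suc p)
     = of_nat (Suc n) * z * (\<Sum>q\<le>p. of_nat (p choose q) * bern_sum y z n (\<lambda>\<nu>. of_nat \<nu> ^ q))"
proof -
  have "bern_sum y z n (\<lambda>\<nu>. of_nat (Suc \<nu>) ^ p)
     = bern_sum y z n (\<lambda>\<nu>. \<Sum>q\<le>p. of_nat (p choose q) * of_nat \<nu> ^ q)"
    using binomial_ring[of "of_nat _" "1::complex" p] by (simp only: of_nat_Suc add.commute) simp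
  also have "\<dots> = (\<Sum>q\<le>p. of_nat (p choose q) * bern_sum y z n (\<lambda>\<nu>. of_nat \<nu> ^ q))"
    unfolding bern_sum_def sum_distrib_left
    by (subst sum.swap) (simp add: mult.left_commute mult.commute)
  finally show ?thesis
    using bern_sum_shift[of y z n "\<lambda>\<nu>. of_nat \<nu> ^ p"] by simp
qed

lemma bern_sum_one: "y + z = 1 \<Longrightarrow> bern_sum y z n (\<lambda>\<nu>. 1) = 1"
  using binomial_ring[of z y n] by (simp add: bern_sum_def add.commute mult.assoc mult.commute[of "y ^ _"])

lemma bern_sum_moment_bound:
  assumes yz: "y + z = 1" and \<rho>: "norm z \<le> \<rho>" "1 \<le> \<rho>"
  shows "norm (bern_sum y z n (\<lambda>\<nu>. of_nat \<nu> ^ p)) \<le> (real n * \<rho>) ^ p"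
proof (induction p arbitrary: n rule: less_induct)
  case (less p)
  show ?case
  proof (cases p)
    case 0
    then show ?thesis using bern_sum_one[OF yz] by simp
  next
    case (Suc p')
    show ?thesis
    proof (cases n)
      case 0
      then show ?thesis using Suc by (simp add: bern_sum_def)
    next
      case (Suc m)
      have IH: "norm (bern_sum y z m (\<lambda>\<nu>. of_nat \<nu> ^ q)) \<le> (real m * \<rho>) ^ q" if "q \<le> p'" for q
        using less[of q m] that \<open>p = Suc p'\<close> by simp
      have "norm (\<Sum>q\<le>p'. of_nat (p' choose q) * bern_sum y z m (\<lambda>\<nu>. of_nat \<nu> ^ q))
         \<le> (\<Sum>q\<le>p'. real (p' choose q) * (real m * \<rho>) ^ q)"
        by (intro sum_norm_le) (simp add: norm_mult mult_left_mono IH)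
      also have "\<dots> = (real m * \<rho> + 1) ^ p'"
        by (subst binomial_ring) simp
      \<comment> \<open>Here n = m + 1, and \<rho> >= 1 gives m \<rho> + 1 <= n \<rho>.\<close>
      also have "\<dots> \<le> (real n * \<rho>) ^ p'"
        using \<rho> Suc by (intro power_mono) (auto simp: algebra_simps)
      finally have "real n * norm z * norm (\<Sum>q\<le>p'. of_nat (p' choose q) * bern_sum y z m (\<lambda>\<nu>. of_nat \<nu> ^ q))
        \<le> real n * \<rho> * (real n * \<rho>) ^ p'"
        using \<rho> by (intro mult_mono) auto
      then show ?thesis
        unfolding \<open>p = Suc p'\<close> Suc bern_sum_moment_rec norm_mult norm_of_nat by simp
    qed
  qed
qed

text \<open>In the recursion only the moment of top order survives division by the full power of n +
  1, and it contributes one more factor z.\<close>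

lemma bern_sum_moment_limit:
  assumes yz: "y + z = 1"
  shows "(\<lambda>n. bern_sum y z n (\<lambda>\<nu>. of_nat \<nu> ^ p) / of_nat n ^ p) \<longlonglongrightarrow> z ^ p"
proof (induction p rule: less_induct)
  case (less p)
  show ?case
  proof (cases p)
    case 0
    then show ?thesis using bern_sum_one[OF yz] by simp
  next
    case (Suc p')
    have 1: "(\<lambda>n. of_nat n / of_nat (Suc n) :: complex) \<longlonglongrightarrow> 1"
      using LIMSEQ_n_over_Suc_n[where 'a = complex] by simp
    have 2: "(\<lambda>n. 1 / of_nat (Suc n) :: complex) \<longlonglongrightarrow> 0"
      using LIMSEQ_Suc[OF lim_1_over_n[where 'a = complex]] by simp
    have lim: "(\<lambda>n. bern_sum y z n (\<lambda>\<nu>. of_nat \<nu> ^ q) / of_nat (Suc n) ^ p') \<longlonglongrightarrow> (if q = p' then z ^ p' else 0)"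
      if "q \<le> p'" for q
    proof -
      \<comment> \<open>The three factors tend to z ^ q, 1 and 0 ^ (p' - q): a lower moment is
        killed by the surplus power of n + 1.\<close>
      have conv: "(\<lambda>n. bern_sum y z n (\<lambda>\<nu>. of_nat \<nu> ^ q) / of_nat n ^ q * (of_nat n / of_nat (Suc n)) ^ q * (1 / of_nat (Suc n)) ^ (p' - q))
        \<longlonglongrightarrow> z ^ q * 1 ^ q * 0 ^ (p' - q)"
        by (intro tendsto_mult tendsto_power less 1 2) (use that Suc in auto)
      have eq1: "z ^ q * 1 ^ q * 0 ^ (p' - q) = (if q = p' then z ^ p' else 0)"
        using that by (auto simp: power_0_left)
      have eq2: "bern_sum y z n (\<lambda>\<nu>. of_nat \<nu> ^ q) / of_nat n ^ q * (of_nat n / of_nat (Suc n)) ^ q * (1 / of_nat (Suc n)) ^ (p' - q)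
        = bern_sum y z n (\<lambda>\<nu>. of_nat \<nu> ^ q) / of_nat (Suc n) ^ p'" if "n > 0" for n
      proof -
        have "(of_nat (Suc n) :: complex) ^ p' = of_nat (Suc n) ^ q * of_nat (Suc n) ^ (p' - q)"
          using \<open>q \<le> p'\<close> by (simp only: power_add[symmetric]) simp
        then show ?thesis using that by (simp add: power_divide del: of_nat_Suc)
      qed
      show ?thesis
        using conv unfolding eq1
        by (rule Lim_transform_eventually) (rule eventually_mono[OF eventually_gt_at_top[of 0]], rule eq2)
    qed
    have "(\<lambda>n. z * (\<Sum>q\<le>p'. of_nat (p' choose q) * (bern_sum y z n (\<lambda>\<nu>. of_nat \<nu> ^ q) / of_nat (Suc n) ^ p')))
       \<longlonglongrightarrow> z * (\<Sum>q\<le>p'. of_nat (p' choose q) * (if q = p' then z ^ p' else 0))"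
      by (intro tendsto_mult tendsto_sum tendsto_const lim) auto
    moreover have "(\<Sum>q\<le>p'. of_nat (p' choose q) * (if q = p' then z ^ p' else 0)) = z ^ p'"
      by (simp add: if_distrib sum.delta cong: if_cong)
    moreover have "z * (\<Sum>q\<le>p'. of_nat (p' choose q) * (bern_sum y z n (\<lambda>\<nu>. of_nat \<nu> ^ q) / of_nat (Suc n) ^ p'))
       = bern_sum y z (Suc n) (\<lambda>\<nu>. of_nat \<nu> ^ p) / of_nat (Suc n) ^ p" for n
    proof -
      have "(\<Sum>q\<le>p'. of_nat (p' choose q) * (bern_sum y z n (\<lambda>\<nu>. of_nat \<nu> ^ q) / of_nat (Suc n) ^ p'))
        = (\<Sum>q\<le>p'. of_nat (p' choose q) * bern_sum y z n (\<lambda>\<nu>. of_nat \<nu> ^ q)) / of_nat (Suc n) ^ p'"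
        by (simp only: sum_divide_distrib times_divide_eq_right)
      then show ?thesis
        unfolding Suc bern_sum_moment_rec by (simp del: of_nat_Suc)
    qed
    ultimately have "(\<lambda>n. bern_sum y z (Suc n) (\<lambda>\<nu>. of_nat \<nu> ^ p) / of_nat (Suc n) ^ p) \<longlonglongrightarrow> z ^ p"
      by (simp add: Suc)
    then show ?thesis by (rule LIMSEQ_imp_Suc)
  qed
qed

text \<open>Expanding F around 1, the p-th Taylor term at the nodes 1 - 2 \<nu> / n yields (-2)^p
  times the p-th moment, at most (2 \<rho>)^p. Cauchy's inequality on the circle of radius 4 \<rho>
  bounds the coefficient by B / (4 \<rho>)^p; the radius is chosen so that B / 2^p remains,
  independently of n. The sum is 2 B, and Tannery's theorem gives the limit. That the bound depends
  on F only through B is what the later dominated convergence needs.\<close>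

lemma bern_sum_entire:
  fixes F :: "complex \<Rightarrow> complex"
  assumes F: "F holomorphic_on UNIV" and yz: "y + z = 1" and \<rho>: "norm z \<le> \<rho>" "1 \<le> \<rho>"
    and B: "\<And>w. norm (1 - w) = 4 * \<rho> \<Longrightarrow> norm (F w) \<le> B"
  shows bern_sum_entire_bound: "norm (bern_sum y z n (\<lambda>\<nu>. F (1 - 2 * of_nat \<nu> / of_nat n))) \<le> 2 * B"
    and bern_sum_entire_limit_bounded:
      "(\<lambda>n. bern_sum y z n (\<lambda>\<nu>. F (1 - 2 * of_nat \<nu> / of_nat n))) \<longlonglongrightarrow> F (1 - 2 * z)"
proof -
  define a where "a p = (deriv ^^ p) F 1 / fact p" for p
  have a: "norm (a p) \<le> B / (4 * \<rho>) ^ p" for p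
  proof -
    have "norm ((deriv ^^ p) F 1) \<le> fact p * B / (4 * \<rho>) ^ p"
      using \<rho> B holomorphic_on_subset[OF F]
        continuous_on_subset[OF holomorphic_on_imp_continuous_on[OF F] subset_UNIV]
      by (intro Cauchy_inequality) auto
    then show ?thesis by (simp add: a_def norm_divide field_simps)
  qed
  have taylor: "(\<lambda>p. a p * (w - 1) ^ p) sums F w" for w
    unfolding a_def
    by (rule holomorphic_power_series[of F 1 "dist 1 w + 1"])
       (use holomorphic_on_subset[OF F] in \<open>auto simp: add_pos_nonneg\<close>)
  define m where "m p n = bern_sum y z n (\<lambda>\<nu>. (of_nat \<nu> / of_nat n) ^ p)" for p n
  have m_eq: "m p n = bern_sum y z n (\<lambda>\<nu>. of_nat \<nu> ^ p) / of_nat n ^ p" for p n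
    unfolding m_def bern_sum_def by (simp add: sum_divide_distrib power_divide)
  have m_bound: "norm (m p n) \<le> \<rho> ^ p" for p n
  \<comment> \<open>For n = 0 the quotient is 0 by convention and the moment is 0 ^ p.\<close>
  proof (cases "n = 0")
    case True
    then show ?thesis using \<rho> by (simp add: m_def bern_sum_def power_0_left one_le_power)
  next
    case False
    then show ?thesis unfolding m_eq
      using bern_sum_moment_bound[OF yz \<rho>, of n p] by (simp add: norm_divide norm_power field_simps power_mult_distrib)
  qed
  define t where "t p n = a p * (-2) ^ p * m p n" for p n
  have t_sums: "(\<lambda>p. t p n) sums bern_sum y z n (\<lambda>\<nu>. F (1 - 2 * of_nat \<nu> / of_nat n))" for n
  proof -
    have "t p n = bern_sum y z n (\<lambda>\<nu>. a p * ((1 - 2 * of_nat \<nu> / of_nat n) - 1) ^ p)" for p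
    proof -
      have *: "((1 - 2 * of_nat \<nu> / of_nat n) - 1) ^ p = (-2) ^ p * (of_nat \<nu> / of_nat n :: complex) ^ p" for \<nu>
        unfolding power_mult_distrib[symmetric] by simp
      show ?thesis unfolding t_def m_def bern_sum_def * by (simp add: sum_distrib_left mult_ac)
    qed
    then show ?thesis
      unfolding bern_sum_def by (simp only:) (intro sums_sum sums_mult taylor)
  qed
  have t_bound: "norm (t p n) \<le> B * (1 / 2) ^ p" for p n
  proof -
    have "norm (t p n) \<le> B / (4 * \<rho>) ^ p * 2 ^ p * \<rho> ^ p"
      unfolding t_def norm_mult norm_power norm_neg_numeral
      using \<rho> order_trans[OF norm_ge_zero a[of p]]
      by (intro mult_mono a m_bound mult_nonneg_nonneg) simp_all
    also have "\<dots> = B * ((2 * \<rho>) / (4 * \<rho>)) ^ p"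
      unfolding power_divide power_mult_distrib[of 2] by simp
    also have "(2 * \<rho>) / (4 * \<rho>) = 1 / 2" using \<rho> by simp
    finally show ?thesis .
  qed
  have geo: "(\<lambda>p. B * (1 / 2) ^ p) sums (B * 2)"
    using sums_mult[OF geometric_sums[of "1/2::real"], of B] by simp
  show "norm (bern_sum y z n (\<lambda>\<nu>. F (1 - 2 * of_nat \<nu> / of_nat n))) \<le> 2 * B"
    using norm_suminf_le[of "\<lambda>p. t p n" "\<lambda>p. B * (1 / 2) ^ p"] t_bound geo t_sums[of n]
    by (simp add: sums_iff mult.commute)
  have "((\<lambda>n. \<Sum>p. t p n) \<longlongrightarrow> (\<Sum>p. a p * (-2) ^ p * z ^ p)) sequentially"
  proof (rule tannerys_theorem[THEN conjunct2, THEN conjunct2])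
    show "((\<lambda>n. t p n) \<longlongrightarrow> a p * (-2) ^ p * z ^ p) sequentially" for p
      unfolding t_def m_eq by (intro tendsto_mult tendsto_const bern_sum_moment_limit yz)
    show "\<forall>\<^sub>F (p, n) in at_top \<times>\<^sub>F sequentially. norm (t p n) \<le> B * (1 / 2) ^ p"
      using t_bound by (intro always_eventually) auto
    show "summable (\<lambda>p. B * (1 / 2) ^ p)" using geo by (rule sums_summable)
  qed simp
  moreover have "(\<Sum>p. a p * (-2) ^ p * z ^ p) = F (1 - 2 * z)"
  proof -
    have "(\<lambda>p. a p * ((1 - 2 * z) - 1) ^ p) sums F (1 - 2 * z)" by (rule taylor)
    moreover have "((1 - 2 * z) - 1) ^ p = (-2) ^ p * z ^ p" for p
      unfolding power_mult_distrib[symmetric] by simp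
    ultimately show ?thesis by (simp add: sums_iff mult.assoc)
  qed
  ultimately show "(\<lambda>n. bern_sum y z n (\<lambda>\<nu>. F (1 - 2 * of_nat \<nu> / of_nat n))) \<longlonglongrightarrow> F (1 - 2 * z)"
    using t_sums by (simp add: sums_iff)
qed

lemma bern_sum_entire_limit:
  assumes F: "F holomorphic_on UNIV" and yz: "y + z = 1"
  shows "(\<lambda>n. bern_sum y z n (\<lambda>\<nu>. F (1 - 2 * of_nat \<nu> / of_nat n))) \<longlonglongrightarrow> F (1 - 2 * z)"
proof -
  define \<rho> where "\<rho> = max 1 (norm z)"
  have "compact (F ` sphere 1 (4 * \<rho>))"
    by (intro compact_continuous_image compact_sphere
        continuous_on_subset[OF holomorphic_on_imp_continuous_on[OF F] subset_UNIV])
  from compact_imp_bounded[OF this] obtain B where "\<And>w. w \<in> sphere 1 (4 * \<rho>) \<Longrightarrow> norm (F w) \<le> B"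
    unfolding bounded_iff by blast
  then show ?thesis
    by (intro bern_sum_entire_limit_bounded[OF F yz, of \<rho> B]) (auto simp: \<rho>_def dist_norm)
qed

section \<open>Convergence of the truncations\<close>

lemma norm_evol_term: "norm (evol_term \<alpha> \<omega> X k t x) = norm (X k 0)"
  by (simp add: evol_term_def mat_vec_delta0 norm_mult)

lemma evol_term_diff:
  "evol_term \<alpha> \<omega> X k t x - evol_term \<alpha> \<omega> Y k t x = evol_term \<alpha> \<omega> (\<lambda>j k. X j k - Y j k) k t x"
  by (simp add: evol_term_def mat_vec_delta0 algebra_simps)

context
  fixes V :: "real \<Rightarrow> real"
  assumes c_summable: "(\<lambda>l. norm (fourier_coeff V l)) summable_on UNIV"
begin

text \<open>The threshold P depends on T and not on t: M makes the tail of the coefficients small, N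
  the tail of the scalar exponential.\<close>

lemma exp_trunc_error:
  assumes "0 \<le> T" "0 < \<epsilon>"
  shows "\<exists>P. \<forall>M\<ge>P. \<forall>N\<ge>P. \<forall>t. max 0 t \<le> T \<longrightarrow>
    col_bounded \<epsilon> (\<lambda>j k. mat_exp (B_entry V \<alpha> (of_real \<omega>) t) j k - exp_trunc V \<alpha> \<omega> M N t j k)"
proof -
  define S where "S = (\<Sum>\<^sub>\<infinity>l. norm (fourier_coeff V l))"
  \<comment> \<open>The summand 1 ensures 1 <= s, as \<open>col_bounded_exp_diff\<close>
    requires.\<close>
  define s where "s = S * T + 1"
  have "0 \<le> S" unfolding S_def by (intro infsum_nonneg) auto
  then have s: "1 \<le> s" "S * T \<le> s" using assms by (auto simp: s_def)
  have "(\<lambda>M. coeff_tail V M * T * exp (2 * s)) \<longlonglongrightarrow> 0 * T * exp (2 * s)"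
    by (intro tendsto_intros coeff_tail_tendsto c_summable)
  then have "\<forall>\<^sub>F M in sequentially. coeff_tail V M * T * exp (2 * s) < \<epsilon> / 2"
    using order_tendstoD(2)[of _ _ _ "\<epsilon> / 2"] assms by fastforce
  then obtain P1 where P1: "\<And>M. M \<ge> P1 \<Longrightarrow> coeff_tail V M * T * exp (2 * s) < \<epsilon> / 2"
    by (auto simp: eventually_sequentially)
  have "(\<lambda>n. s ^ n / fact n) sums exp s"
    using exp_converges[of s] by (simp add: divide_inverse mult.commute)
  then have "(\<lambda>N. exp s - (\<Sum>n\<le>N. s ^ n / fact n)) \<longlonglongrightarrow> exp s - exp s"
    unfolding sums_def_le by (intro tendsto_intros)
  then have "\<forall>\<^sub>F N in sequentially. exp s - (\<Sum>n\<le>N. s ^ n / fact n) < \<epsilon> / 2"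
    using order_tendstoD(2)[of _ _ _ "\<epsilon> / 2"] assms by fastforce
  then obtain P2 where P2: "\<And>N. N \<ge> P2 \<Longrightarrow> exp s - (\<Sum>n\<le>N. s ^ n / fact n) < \<epsilon> / 2"
    by (auto simp: eventually_sequentially)
  show ?thesis
  proof (intro exI[of _ "max P1 P2"] allI impI)
    fix M N :: nat and t :: real assume MN: "M \<ge> max P1 P2" "N \<ge> max P1 P2" and t: "max 0 t \<le> T"
    have X: "col_bounded s (B_entry V \<alpha> (of_real \<omega>) t)"
      using col_bounded_B_entry[OF c_summable t] s(2) unfolding S_def by (rule col_bounded_mono)
    have "col_bounded (coeff_tail V M * T * exp (2 * s) + (exp s - (\<Sum>n\<le>N. s ^ n / fact n)))
      (\<lambda>j k. mat_exp (B_entry V \<alpha> (of_real \<omega>) t) j k - exp_trunc V \<alpha> \<omega> M N t j k)"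
      unfolding exp_trunc_eq
      by (intro col_bounded_exp_diff X col_bounded_band_part col_bounded_band_diff c_summable t s)
    then show "col_bounded \<epsilon> (\<lambda>j k. mat_exp (B_entry V \<alpha> (of_real \<omega>) t) j k - exp_trunc V \<alpha> \<omega> M N t j k)"
      by (rule col_bounded_mono) (use P1[of M] P2[of N] MN in auto)
  qed
qed

text \<open>The description is well defined: column errors dominate entries, so the limit exists
  uniformly in (j, k), and limits of single entries along the nontrivial product filter are
  unique.\<close>

lemma exp_int_A_eq: "exp_int_A V \<alpha> \<omega> t = mat_exp (B_entry V \<alpha> (of_real \<omega>) t)"
  unfolding exp_int_A_def
proof (rule the_equality)
  define E where "E = mat_exp (B_entry V \<alpha> (of_real \<omega>) t)"
  show lim: "uniform_limit UNIV (\<lambda>(M, N) (j, k). exp_trunc V \<alpha> \<omega> M N t j k) (\<lambda>(j, k). E j k) (at_top \<times>\<^sub>F at_top)"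
    unfolding uniform_limit_iff
  proof (intro allI impI)
    fix e :: real assume "0 < e"
    then have half: "0 < e / 2" by simp
    obtain P where P: "\<And>M N t'. M \<ge> P \<Longrightarrow> N \<ge> P \<Longrightarrow> max 0 t' \<le> max 0 t \<Longrightarrow>
      col_bounded (e / 2) (\<lambda>j k. mat_exp (B_entry V \<alpha> (of_real \<omega>) t') j k - exp_trunc V \<alpha> \<omega> M N t' j k)"
      using exp_trunc_error[OF max.cobounded1 half, of t \<alpha> \<omega>] by blast
    have "dist (exp_trunc V \<alpha> \<omega> M N t j k) (E j k) < e" if "M \<ge> P" "N \<ge> P" for M N j k
      using col_bounded_entry[OF P[OF that order_refl], of j k] \<open>0 < e\<close>
      by (simp add: dist_norm norm_minus_commute E_def)
    then show "\<forall>\<^sub>F n in at_top \<times>\<^sub>F at_top. \<forall>x\<in>UNIV.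
        dist ((case n of (M, N) \<Rightarrow> \<lambda>(j, k). exp_trunc V \<alpha> \<omega> M N t j k) x) (case x of (j, k) \<Rightarrow> E j k) < e"
      unfolding eventually_prod_sequentially by (auto intro!: exI[of _ P])
  qed
  fix E' assume "uniform_limit UNIV (\<lambda>(M, N) (j, k). exp_trunc V \<alpha> \<omega> M N t j k) (\<lambda>(j, k). E' j k) (at_top \<times>\<^sub>F at_top)"
  note lim' = this
  have "E' j k = E j k" for j k
  proof (rule tendsto_unique)
    show "((\<lambda>p. (case p of (M, N) \<Rightarrow> \<lambda>(j, k). exp_trunc V \<alpha> \<omega> M N t j k) (j, k)) \<longlongrightarrow> E j k) (at_top \<times>\<^sub>F at_top)"
      using tendsto_uniform_limitI[OF lim, of "(j, k)"] by simp
    show "((\<lambda>p. (case p of (M, N) \<Rightarrow> \<lambda>(j, k). exp_trunc V \<alpha> \<omega> M N t j k) (j, k)) \<longlongrightarrow> E' j k) (at_top \<times>\<^sub>F at_top)"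
      using tendsto_uniform_limitI[OF lim', of "(j, k)"] by simp
  qed (simp add: prod_filter_eq_bot)
  then show "E' = E" by (intro ext)
qed

lemma col_bounded_exp_trunc:
  assumes "max 0 t \<le> T"
  shows "col_bounded (exp ((\<Sum>\<^sub>\<infinity>l. norm (fourier_coeff V l)) * T)) (exp_trunc V \<alpha> \<omega> M N t)"
  unfolding exp_trunc_eq
  by (intro col_bounded_exp_part col_bounded_band_part col_bounded_B_entry c_summable assms)

lemma evol_trunc_bound:
  assumes "max 0 t \<le> T"
  shows "norm (evol_trunc V \<alpha> \<omega> K M N (t, x)) \<le> exp ((\<Sum>\<^sub>\<infinity>l. norm (fourier_coeff V l)) * T)"
proof -
  have "norm (evol_trunc V \<alpha> \<omega> K M N (t, x)) \<le> (\<Sum>k\<in>{-int K..int K}. norm (exp_trunc V \<alpha> \<omega> M N t k 0))"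
    unfolding evol_trunc_def prod.case norm_evol_term[symmetric, of _ _ \<alpha> \<omega> t x] by (rule norm_sum)
  also have "\<dots> \<le> exp ((\<Sum>\<^sub>\<infinity>l. norm (fourier_coeff V l)) * T)"
    by (intro col_boundedD[OF col_bounded_exp_trunc[OF assms]]) auto
  finally show ?thesis .
qed

lemma evol_trunc_error:
  assumes "0 \<le> T" "0 < \<epsilon>"
  shows "\<exists>P. \<forall>K\<ge>P. \<forall>M\<ge>P. \<forall>N\<ge>P. \<forall>t x. max 0 t \<le> T \<longrightarrow>
    norm (evol_trunc V \<alpha> \<omega> K M N (t, x) - evol V \<alpha> \<omega> (t, x)) \<le> \<epsilon>"
proof -
  obtain P where P: "\<And>M N t. M \<ge> P \<Longrightarrow> N \<ge> P \<Longrightarrow> max 0 t \<le> T \<Longrightarrow>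
    col_bounded (\<epsilon> / 2) (\<lambda>j k. mat_exp (B_entry V \<alpha> (of_real \<omega>) t) j k - exp_trunc V \<alpha> \<omega> M N t j k)"
    using exp_trunc_error[OF assms(1) half_gt_zero[OF assms(2)], of \<alpha> \<omega>] by blast
  show ?thesis
  \<comment> \<open>K has to reach the bandwidth P * P of the truncation with both parameters equal
    to P; for M and N the threshold P is enough.\<close>
  proof (intro exI[of _ "max P (P * P)"] allI impI)
    fix K M N t x assume K: "K \<ge> max P (P * P)" and MN: "M \<ge> max P (P * P)" "N \<ge> max P (P * P)"
      and t: "max 0 t \<le> T"
    define E where "E = mat_exp (B_entry V \<alpha> (of_real \<omega>) t)"
    define I where "I = {-int K..int K}"
    have E: "col_bounded (exp ((\<Sum>\<^sub>\<infinity>l. norm (fourier_coeff V l)) * T)) E"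
      unfolding E_def by (intro col_bounded_mat_exp col_bounded_B_entry c_summable t)
    have summ: "(\<lambda>k. norm (evol_term \<alpha> \<omega> E k t x)) summable_on A" for A
      unfolding norm_evol_term by (rule col_bounded_summable[OF E])
    then have summ': "(\<lambda>k. evol_term \<alpha> \<omega> E k t x) summable_on A" for A
      by (rule Infinite_Sum.abs_summable_summable)
    have tail: "norm (\<Sum>\<^sub>\<infinity>k\<in>- I. evol_term \<alpha> \<omega> E k t x) \<le> \<epsilon> / 2"
    proof -
      have "norm (\<Sum>\<^sub>\<infinity>k\<in>- I. evol_term \<alpha> \<omega> E k t x) \<le> (\<Sum>\<^sub>\<infinity>k\<in>- I. norm (evol_term \<alpha> \<omega> E k t x))"
        by (rule norm_infsum_bound[OF summ])
      also have "\<dots> \<le> \<epsilon> / 2"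
      proof (rule infsum_le_finite_sums[OF summ])
        fix F assume F: "finite F" "F \<subseteq> - I"
        have "exp_trunc V \<alpha> \<omega> P P t k 0 = 0" if "k \<in> F" for k
        proof -
          have "banded (P * P) (exp_trunc V \<alpha> \<omega> P P t)"
            unfolding exp_trunc_eq by (intro banded_exp_part banded_band_part)
          moreover have "int (P * P) < \<bar>k - 0\<bar>"
          proof -
            have "int K < \<bar>k\<bar>" using F that by (force simp: I_def)
            moreover have "int (P * P) \<le> int K" using K by (simp del: of_nat_mult)
            ultimately show ?thesis by simp
          qed
          ultimately show ?thesis unfolding banded_def by blast
        qed
        \<comment> \<open>On F the comparison truncation is 0, so subtracting it changes nothing and
          exhibits the tail as part of a column error.\<close>
        then have "(\<Sum>k\<in>F. norm (evol_term \<alpha> \<omega> E k t x)) = (\<Sum>k\<in>F. norm (E k 0 - exp_trunc V \<alpha> \<omega> P P t k 0))"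
          by (intro sum.cong) (auto simp: norm_evol_term)
        also have "\<dots> \<le> \<epsilon> / 2"
          using col_boundedD[OF P[OF order_refl order_refl t] F(1)] unfolding E_def .
        finally show "(\<Sum>k\<in>F. norm (evol_term \<alpha> \<omega> E k t x)) \<le> \<epsilon> / 2" .
      qed
      finally show ?thesis .
    qed
    have "evol V \<alpha> \<omega> (t, x) = (\<Sum>\<^sub>\<infinity>k\<in>I \<union> - I. evol_term \<alpha> \<omega> E k t x)"
      by (simp add: evol_def exp_int_A_eq E_def)
    also have "\<dots> = (\<Sum>k\<in>I. evol_term \<alpha> \<omega> E k t x) + (\<Sum>\<^sub>\<infinity>k\<in>- I. evol_term \<alpha> \<omega> E k t x)"
      by (subst infsum_Un_disjoint) (auto intro!: summ' simp: I_def)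
    finally have "evol_trunc V \<alpha> \<omega> K M N (t, x) - evol V \<alpha> \<omega> (t, x)
      = (\<Sum>k\<in>I. evol_term \<alpha> \<omega> (exp_trunc V \<alpha> \<omega> M N t) k t x - evol_term \<alpha> \<omega> E k t x) - (\<Sum>\<^sub>\<infinity>k\<in>- I. evol_term \<alpha> \<omega> E k t x)"
      by (simp add: evol_trunc_def I_def sum_subtractf)
    also have "norm \<dots> \<le> \<epsilon> / 2 + \<epsilon> / 2"
    proof (rule order_trans[OF norm_triangle_ineq4 add_mono[OF _ tail]])
      have "norm (\<Sum>k\<in>I. evol_term \<alpha> \<omega> (exp_trunc V \<alpha> \<omega> M N t) k t x - evol_term \<alpha> \<omega> E k t x)
        \<le> (\<Sum>k\<in>I. norm (E k 0 - exp_trunc V \<alpha> \<omega> M N t k 0))"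
        by (rule order_trans[OF norm_sum])
           (simp add: evol_term_diff norm_evol_term norm_minus_commute)
      also have "\<dots> \<le> \<epsilon> / 2"
        using col_boundedD[OF P[OF max.bounded_iff[THEN iffD1, OF MN(1), THEN conjunct1] max.bounded_iff[THEN iffD1, OF MN(2), THEN conjunct1] t], of I]
        unfolding E_def by (simp add: I_def)
      finally show "norm (\<Sum>k\<in>I. evol_term \<alpha> \<omega> (exp_trunc V \<alpha> \<omega> M N t) k t x - evol_term \<alpha> \<omega> E k t x) \<le> \<epsilon> / 2" .
    qed
    finally show "norm (evol_trunc V \<alpha> \<omega> K M N (t, x) - evol V \<alpha> \<omega> (t, x)) \<le> \<epsilon>" by simp
  qed
qed

text \<open>One sequence suffices to hand measurability and the bound on time slabs over to the
  limit; the diagonal provides it.\<close>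

lemma evol_trunc_pointwise: "(\<lambda>n. evol_trunc V \<alpha> \<omega> n n n z) \<longlonglongrightarrow> evol V \<alpha> \<omega> z"
proof (rule LIMSEQ_I)
  fix e :: real assume e: "0 < e"
  obtain t x where z: "z = (t, x)" by (cases z)
  obtain P where "\<And>K M N t' x'. K \<ge> P \<Longrightarrow> M \<ge> P \<Longrightarrow> N \<ge> P \<Longrightarrow> max 0 t' \<le> max 0 t \<Longrightarrow>
      norm (evol_trunc V \<alpha> \<omega> K M N (t', x') - evol V \<alpha> \<omega> (t', x')) \<le> e / 2"
    using evol_trunc_error[OF max.cobounded1 half_gt_zero[OF e], of t \<alpha> \<omega>] by blast
  from this[OF _ _ _ order_refl]
  have "norm (evol_trunc V \<alpha> \<omega> n n n z - evol V \<alpha> \<omega> z) \<le> e / 2" if "n \<ge> P" for n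
    using that by (simp add: z)
  then show "\<exists>no. \<forall>n\<ge>no. norm (evol_trunc V \<alpha> \<omega> n n n z - evol V \<alpha> \<omega> z) < e"
    using e by (intro exI[of _ P]) force
qed

lemma evol_bound:
  assumes "max 0 t \<le> T"
  shows "norm (evol V \<alpha> \<omega> (t, x)) \<le> exp ((\<Sum>\<^sub>\<infinity>l. norm (fourier_coeff V l)) * T)"
  by (rule LIMSEQ_le_const2[OF tendsto_norm[OF evol_trunc_pointwise]])
     (use evol_trunc_bound[OF assms] in auto)

end

section \<open>Analytic continuation in the frequency\<close>

text \<open>Every \<omega>, including the one in the matrix entries, becomes w. The phases that
  contain w are complex exponentials, as off the real line they are no longer of modulus 1.\<close>

definition evol_analytic ::
    "(real \<Rightarrow> real) \<Rightarrow> real \<Rightarrow> nat \<Rightarrow> nat \<Rightarrow> nat \<Rightarrow> complex \<Rightarrow> real \<times> real \<Rightarrow> complex" where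
  "evol_analytic V \<alpha> K M N w = (\<lambda>(t, x). \<Sum>k = -int K..int K.
     cis (- \<alpha> * (real_of_int k)\<^sup>2 * t) * exp_part (band_part M (B_entry V \<alpha> w t)) N k 0
       * exp (- \<i> * (w\<^sup>2 * of_real t)) * exp (- \<i> * (2 * of_int k * w * of_real t))
       * exp (\<i> * ((of_int k + w) * of_real x)))"

lemma evol_analytic_of_real: "evol_analytic V \<alpha> K M N (of_real \<omega>) = evol_trunc V \<alpha> \<omega> K M N"
  unfolding evol_analytic_def evol_trunc_def evol_term_def mat_vec_delta0 exp_trunc_eq cis_conv_exp
  by (simp add: fun_eq_iff mult.assoc)

lemma banded_pow_Suc:
  "mat_pow (band_part M X) (Suc n) j k =
     (\<Sum>l = j - int M..j + int M. band_part M X j l * mat_pow (band_part M X) n l k)"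
  by (simp add: banded_mult_entry[OF banded_band_part])

lemma holomorphic_mat_pow:
  "(\<lambda>w. mat_pow (band_part M (B_entry V \<alpha> w t)) n j k) holomorphic_on UNIV"
proof (induction n arbitrary: j k)
  case (Suc n)
  have "(\<lambda>w. band_part M (B_entry V \<alpha> w t) j k) holomorphic_on UNIV" for j k
    unfolding band_part_def B_entry_def
    by (cases "\<bar>j - k\<bar> \<le> int M") (auto intro!: holomorphic_intros)
  then show ?case
    unfolding banded_pow_Suc by (intro holomorphic_intros Suc)
qed simp

lemma continuous_mat_pow:
  "continuous_on UNIV (\<lambda>(w, t). mat_pow (band_part M (B_entry V \<alpha> w t)) n j k)"
proof (induction n arbitrary: j k)
  case (Suc n)
  have "continuous_on UNIV (\<lambda>(w, t). band_part M (B_entry V \<alpha> w t) j k)" for j k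
    unfolding band_part_def B_entry_def
    by (cases "\<bar>j - k\<bar> \<le> int M") (auto intro!: continuous_intros simp: case_prod_unfold)
  then show ?case
    using Suc unfolding banded_pow_Suc case_prod_unfold by (intro continuous_intros)
qed simp

lemma evol_analytic_holomorphic: "(\<lambda>w. evol_analytic V \<alpha> K M N w z) holomorphic_on UNIV"
  unfolding evol_analytic_def exp_part_def case_prod_unfold
  by (intro holomorphic_intros holomorphic_mat_pow) auto

text \<open>Continuity is joint, so that the values are bounded on a disc of frequencies times the
  support of a test function.\<close>

lemma evol_analytic_continuous: "continuous_on A (\<lambda>(w, z). evol_analytic V \<alpha> K M N w z)"
proof -
  have "continuous_on UNIV (\<lambda>p :: complex \<times> real \<times> real. mat_pow (band_part M (B_entry V \<alpha> (fst p) (fst (snd p)))) n j k)" for n j k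
    using continuous_on_compose2[OF continuous_mat_pow[of M V \<alpha> n j k], of UNIV "\<lambda>p :: complex \<times> real \<times> real. (fst p, fst (snd p))"]
    by (simp add: continuous_on_Pair continuous_on_fst continuous_on_snd)
  then have "continuous_on UNIV (\<lambda>(w, z). evol_analytic V \<alpha> K M N w z)"
    unfolding evol_analytic_def exp_part_def case_prod_unfold by (intro continuous_intros) auto
  then show ?thesis by (rule continuous_on_subset) auto
qed

lemma evol_trunc_continuous: "continuous_on A (evol_trunc V \<alpha> \<omega> K M N)"
proof -
  have "continuous_on A (\<lambda>z. case (of_real \<omega>, z) of (w, z) \<Rightarrow> evol_analytic V \<alpha> K M N w z)"
    by (rule continuous_on_compose2[OF evol_analytic_continuous[of UNIV V \<alpha> K M N]]) (auto intro!: continuous_intros)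
  then show ?thesis by (simp add: evol_analytic_of_real)
qed

section \<open>Test functions\<close>

lemma supp_outside: "z \<notin> supp f \<Longrightarrow> f z = 0"
  unfolding supp_def using closure_subset[of "{z. f z \<noteq> 0}"] by auto

lemma supp_partial_deriv: "supp (partial_deriv v f) \<subseteq> supp f"
proof -
  have "partial_deriv v f z = 0" if z: "z \<notin> supp f" for z
  proof -
    have "((\<lambda>_. 0) has_derivative (\<lambda>_. 0)) (at z)" by simp
    then have "(f has_derivative (\<lambda>_. 0)) (at z)"
      by (rule has_derivative_transform_within_open[of _ _ _ _ "- supp f"])
         (use z supp_outside in \<open>auto simp: supp_def\<close>)
    then show ?thesis by (simp add: partial_deriv_def frechet_derivative_at[symmetric])
  qed
  then show ?thesis
    unfolding supp_def[of "partial_deriv v f"] by (intro closure_minimal) (auto simp: supp_def)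
qed

lemma supp_fold_partial_deriv: "supp (fold partial_deriv vs f) \<subseteq> supp f"
proof (induction vs arbitrary: f)
  case (Cons v vs)
  show ?case using Cons[of "partial_deriv v f"] supp_partial_deriv[of v f] by auto
qed simp

lemma smooth_fold: "smooth f \<Longrightarrow> set vs \<subseteq> Basis \<Longrightarrow> smooth (fold partial_deriv vs f)"
  by (induction vs arbitrary: f) (auto intro: smooth_partial_deriv)

lemma partial_deriv_add:
  "f differentiable at z \<Longrightarrow> g differentiable at z \<Longrightarrow>
    partial_deriv v (\<lambda>z. f z + g z) z = partial_deriv v f z + partial_deriv v g z"
  unfolding partial_deriv_def
  by (subst frechet_derivative_at[symmetric, OF has_derivative_add])
     (auto simp: frechet_derivative_works[symmetric])

lemma partial_deriv_cmult:
  fixes f :: "'a::euclidean_space \<Rightarrow> complex"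
  shows "f differentiable at z \<Longrightarrow> partial_deriv v (\<lambda>z. c * f z) z = c * partial_deriv v f z"
  unfolding partial_deriv_def
  by (subst frechet_derivative_at[symmetric, OF has_derivative_mult_right])
     (auto simp: frechet_derivative_works[symmetric])

text \<open>Boundedness of the derivatives is what makes the real-valued \<open>SUP\<close> an
  actual upper bound.\<close>

lemma Cm_norm_upper:
  assumes "\<And>vs. set vs \<subseteq> Basis \<Longrightarrow> bounded (range (fold partial_deriv vs f))"
    and vs: "set vs \<subseteq> Basis" "length vs \<le> m"
  shows "norm (fold partial_deriv vs f z) \<le> Cm_norm m f"
proof -
  have up: "norm (fold partial_deriv us f z) \<le> (SUP z. norm (fold partial_deriv us f z))"
    if "set us \<subseteq> Basis" for us z
    using assms(1)[OF that] by (intro cSUP_upper) (auto simp: bounded_iff bdd_above_def)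
  note up[OF vs(1)]
  also have "(SUP z. norm (fold partial_deriv vs f z)) \<le> Cm_norm m f"
    unfolding Cm_norm_def
    by (rule member_le_sum[of vs _ "\<lambda>vs. SUP z. norm (fold partial_deriv vs f z)"])
       (use vs in \<open>auto intro: order_trans[OF norm_ge_zero up] finite_lists_length_le\<close>)
  finally show ?thesis .
qed

lemma tests_plane_bounded:
  assumes "f \<in> tests_plane" "set vs \<subseteq> Basis"
  shows "bounded (range (fold partial_deriv vs f))"
proof -
  let ?g = "fold partial_deriv vs f"
  have "compact (?g ` supp f)"
    using assms by (intro compact_continuous_image smooth_continuous_on smooth_fold)
      (auto simp: tests_plane_def)
  then have "bounded (insert 0 (?g ` supp f))" by (simp add: compact_imp_bounded)
  moreover have "range ?g \<subseteq> insert 0 (?g ` supp f)"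
    using supp_outside supp_fold_partial_deriv[of vs f] by fastforce
  ultimately show ?thesis by (rule bounded_subset)
qed

lemma partial_deriv_periodic:
  fixes f :: "real \<times> real \<Rightarrow> complex"
  assumes "smooth f" "\<And>t \<theta>. f (t, \<theta> + p) = f (t, \<theta>)"
  shows "partial_deriv v f (t, \<theta> + p) = partial_deriv v f (t, \<theta>)"
proof -
  have "f = f \<circ> (\<lambda>z. z + (0, p))" using assms(2) by (auto simp: fun_eq_iff)
  have "(f has_derivative frechet_derivative f (at (t, \<theta> + p))) (at ((t, \<theta>) + (0, p)))"
    using smooth_differentiable[OF assms(1)] by (simp add: frechet_derivative_works[symmetric])
  moreover have "((\<lambda>z. z + (0, p)) has_derivative (\<lambda>z. z)) (at (t, \<theta>))"
    by (auto intro!: derivative_eq_intros)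
  ultimately have "(f \<circ> (\<lambda>z. z + (0, p)) has_derivative frechet_derivative f (at (t, \<theta> + p)) \<circ> (\<lambda>z. z)) (at (t, \<theta>))"
    by (intro diff_chain_at)
  then have "(f has_derivative frechet_derivative f (at (t, \<theta> + p))) (at (t, \<theta>))"
    using \<open>f = _\<close> by (simp add: o_def)
  then show ?thesis by (simp add: partial_deriv_def frechet_derivative_at[symmetric])
qed

lemma fold_partial_deriv_periodic:
  fixes f :: "real \<times> real \<Rightarrow> complex"
  assumes "smooth f" "\<And>t \<theta>. f (t, \<theta> + p) = f (t, \<theta>)" "set vs \<subseteq> Basis"
  shows "fold partial_deriv vs f (t, \<theta> + p) = fold partial_deriv vs f (t, \<theta>)"
  using assms
proof (induction vs arbitrary: f)
  case (Cons v vs)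
  then show ?case
    by (simp add: partial_deriv_periodic smooth_partial_deriv)
qed simp

text \<open>The lift of a test function need not have compact support in the plane; its derivatives
  are bounded because their values already occur on one period in \<theta>.\<close>

lemma tests_cylinder_bounded:
  assumes f: "f \<in> tests_cylinder" and vs: "set vs \<subseteq> Basis"
  shows "bounded (range (fold partial_deriv vs f))"
proof -
  let ?g = "fold partial_deriv vs f"
  obtain K where K: "compact K" "supp f \<subseteq> K \<times> UNIV" and sm: "smooth f"
    and per: "\<And>t \<theta>. f (t, \<theta> + 2 * pi) = f (t, \<theta>)"
    using f by (auto simp: tests_cylinder_def)
  have "compact (?g ` (K \<times> {0..2*pi}))"
    by (intro compact_continuous_image smooth_continuous_on smooth_fold sm vs compact_Times K compact_Icc)
  then have "bounded (insert 0 (?g ` (K \<times> {0..2*pi})))" by (simp add: compact_imp_bounded)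
  moreover have "?g (t, \<theta>) \<in> insert 0 (?g ` (K \<times> {0..2*pi}))" for t \<theta>
  proof (cases "t \<in> K")
    case False
    then have "(t, \<theta>) \<notin> supp ?g" using K supp_fold_partial_deriv[of vs f] by auto
    then show ?thesis using supp_outside by blast
  next
    case True
    interpret periodic_fun_simple "\<lambda>\<theta>. ?g (t, \<theta>)" "2 * pi"
      by standard (rule fold_partial_deriv_periodic[OF sm per vs])
    let ?n = "\<lfloor>\<theta> / (2 * pi)\<rfloor>"
    have "0 \<le> \<theta> - of_int ?n * (2 * pi)" "\<theta> - of_int ?n * (2 * pi) \<le> 2 * pi"
      using floor_divide_lower[of "2 * pi" \<theta>] floor_divide_upper[of "2 * pi" \<theta>]
      by (auto simp: algebra_simps)
    moreover have "?g (t, \<theta>) = ?g (t, \<theta> - of_int ?n * (2 * pi))" by (simp add: minus_of_int)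
    ultimately show ?thesis using True by auto
  qed
  then have "range ?g \<subseteq> insert 0 (?g ` (K \<times> {0..2*pi}))" by auto
  ultimately show ?thesis by (rule bounded_subset)
qed

section \<open>Functions bounded on time slabs as distributions\<close>

text \<open>The class that contains the truncations and their limit. No decay in x is asked, and
  negative times are left free since \<open>dist_of_fun\<close> cuts them off.\<close>

definition slab_bounded :: "(real \<times> real \<Rightarrow> complex) \<Rightarrow> bool" where
  "slab_bounded g \<longleftrightarrow> g \<in> borel_measurable borel \<and>
     (\<forall>T. \<exists>C. \<forall>t x. 0 \<le> t \<and> t \<le> T \<longrightarrow> norm (g (t, x)) \<le> C)"

abbreviation future :: "(real \<times> real) set" where
  "future \<equiv> {0..} \<times> UNIV"

lemma future_measurable [measurable]: "future \<in> sets borel"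
  by (intro borel_closed closed_Times) auto

lemma set_integrable_dominated:
  fixes h :: "real \<times> real \<Rightarrow> complex" and u :: "real \<times> real \<Rightarrow> real"
  assumes "h \<in> borel_measurable borel" "integrable lborel u"
    and "\<And>t x. 0 \<le> t \<Longrightarrow> norm (h (t, x)) \<le> u (t, x)" "\<And>z. 0 \<le> u z"
  shows "set_integrable lborel future h" "norm (LINT z:future|lborel. h z) \<le> (\<integral>z. u z \<partial>lborel)"
proof -
  have *: "norm (indicator future z *\<^sub>R h z) \<le> u z" for z
    using assms(3)[of "fst z" "snd z"] assms(4)[of z] by (cases z) (auto simp: indicator_def)
  have "integrable lborel (\<lambda>z. indicator future z *\<^sub>R h z)"
    by (rule Bochner_Integration.integrable_bound[OF assms(2)])
       (use * assms(1,4) in \<open>auto intro!: AE_I2\<close>)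
  then show "set_integrable lborel future h" by (simp add: set_integrable_def)
  show "norm (LINT z:future|lborel. h z) \<le> (\<integral>z. u z \<partial>lborel)"
    unfolding set_lebesgue_integral_def
    by (rule Bochner_Integration.integral_norm_bound_integral) (use * assms(2) \<open>integrable lborel (\<lambda>z. indicator future z *\<^sub>R h z)\<close> in auto)
qed

lemma tests_plane_continuous: "f \<in> tests_plane \<Longrightarrow> continuous_on A f"
  by (auto simp: tests_plane_def intro: smooth_continuous_on)

text \<open>Integrability is part of the conclusion because additivity of \<open>dist_of_fun\<close>
  relies on it.\<close>

lemma dist_of_fun_plane_bound:
  assumes g: "slab_bounded g" and K: "compact K"
  shows "\<exists>C. \<forall>f\<in>tests_plane. supp f \<subseteq> K \<longrightarrow>
     set_integrable lborel future (\<lambda>z. g z * f z) \<and> norm (dist_of_fun g f) \<le> C * Cm_norm 0 f"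
proof -
  obtain T where T: "\<And>z. z \<in> K \<Longrightarrow> norm z \<le> T"
    using compact_imp_bounded[OF K] by (auto simp: bounded_iff)
  obtain C where C: "\<And>t x. 0 \<le> t \<Longrightarrow> t \<le> T \<Longrightarrow> norm (g (t, x)) \<le> C"
    using g unfolding slab_bounded_def by blast
  have "set_integrable lborel future (\<lambda>z. g z * f z) \<and> norm (dist_of_fun g f) \<le> (\<bar>C\<bar> * measure lborel K) * Cm_norm 0 f"
    if f: "f \<in> tests_plane" and supp: "supp f \<subseteq> K" for f
  proof -
    define N where "N = Cm_norm 0 f"
    have N: "norm (f z) \<le> N" for z
      using Cm_norm_upper[of f "[]" 0 z] tests_plane_bounded[OF f] by (simp add: N_def)
    define u where "u = (\<lambda>z. indicator K z *\<^sub>R (\<bar>C\<bar> * N))"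
    have int: "integrable lborel u"
      unfolding u_def using emeasure_compact_finite[OF K] K
      by (intro integrable_indicator) (auto simp: borel_compact)
    have meas: "(\<lambda>z. g z * f z) \<in> borel_measurable borel"
      using g borel_measurable_continuous_onI[OF tests_plane_continuous[OF f]]
      unfolding slab_bounded_def by (intro borel_measurable_times) auto
    have "norm (g (t, x) * f (t, x)) \<le> u (t, x)" if "0 \<le> t" for t x
    proof (cases "(t, x) \<in> K")
      case True
      then have "t \<le> T" using T[OF True] norm_fst_le[of t x] by auto
      then have "norm (g (t, x)) \<le> \<bar>C\<bar>" using C[of t x] that by linarith
      then show ?thesis using True N by (simp add: u_def norm_mult mult_mono)
    next
      case False
      then show ?thesis using supp supp_outside[of "(t, x)" f] by (auto simp: u_def)
    qed
    moreover have "0 \<le> u z" for z using order_trans[OF norm_ge_zero N] by (simp add: u_def)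
    moreover have "(\<integral>z. u z \<partial>lborel) = (\<bar>C\<bar> * measure lborel K) * N"
      unfolding u_def real_scaleR_def by simp
    ultimately show ?thesis
      using set_integrable_dominated[OF meas int] unfolding dist_of_fun_def N_def by auto
  qed
  then show ?thesis by blast
qed

lemma dist_of_fun_integrable:
  assumes "slab_bounded g" "f \<in> tests_plane"
  shows "set_integrable lborel future (\<lambda>z. g z * f z)"
  using dist_of_fun_plane_bound[OF assms(1), of "supp f"] assms(2) by (auto simp: tests_plane_def)

lemma dist_of_fun_add:
  assumes "slab_bounded g" "f \<in> tests_plane" "h \<in> tests_plane"
  shows "dist_of_fun g (\<lambda>z. f z + h z) = dist_of_fun g f + dist_of_fun g h"
  using set_integral_add(2)[OF dist_of_fun_integrable[OF assms(1,2)] dist_of_fun_integrable[OF assms(1,3)]]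
  by (simp add: dist_of_fun_def distrib_left)

lemma dist_of_fun_cmult: "dist_of_fun g (\<lambda>z. c * f z) = c * dist_of_fun g f"
  unfolding dist_of_fun_def by (subst set_integral_mult_right[symmetric]) (simp add: mult.left_commute)

lemma dist_of_fun_past:
  assumes "supp f \<subseteq> {..<0} \<times> UNIV"
  shows "dist_of_fun g f = 0"
proof -
  have "f z = 0" if "z \<in> future" for z
    using assms that by (intro supp_outside) auto
  then have "(\<lambda>z. indicator future z *\<^sub>R (g z * f z)) = (\<lambda>z. 0)"
    by (auto simp: indicator_def)
  then show ?thesis unfolding dist_of_fun_def set_lebesgue_integral_def by (simp only: integral_zero)
qed

text \<open>\<open>converges_dist_plane\<close> demands that every Bernstein sum be itself a
  distribution.\<close>

lemma lincomb_in_dist_plane: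
  fixes c :: "'i \<Rightarrow> complex"
  assumes g: "\<And>i. i \<in> I \<Longrightarrow> slab_bounded (g i)"
  shows "(\<lambda>f. \<Sum>i\<in>I. c i * dist_of_fun (g i) f) \<in> dist_plane"
  unfolding dist_plane_def distributions_def
proof (safe, goal_cases)
  case (1 f h)
  then show ?case using g by (simp add: dist_of_fun_add distrib_left sum.distrib)
next
  case (2 c f)
  then show ?case by (simp add: dist_of_fun_cmult sum_distrib_left mult.left_commute)
next
  case (3 K)
  then have "\<forall>i\<in>I. \<exists>C. \<forall>f\<in>tests_plane. supp f \<subseteq> K \<longrightarrow> norm (dist_of_fun (g i) f) \<le> C * Cm_norm 0 f"
    using dist_of_fun_plane_bound g by meson
  then obtain C where C: "\<And>i f. i \<in> I \<Longrightarrow> f \<in> tests_plane \<Longrightarrow> supp f \<subseteq> K \<Longrightarrow>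
     norm (dist_of_fun (g i) f) \<le> C i * Cm_norm 0 f"
    by metis
  have "norm (\<Sum>i\<in>I. c i * dist_of_fun (g i) f) \<le> (\<Sum>i\<in>I. norm (c i) * C i) * Cm_norm 0 f"
    if "f \<in> tests_plane" "supp f \<subseteq> K" for f
    unfolding sum_distrib_right mult.assoc
    by (intro sum_norm_le) (auto simp: norm_mult intro!: mult_left_mono C that)
  then show ?case by blast
next
  case (4 f)
  then show ?case by (simp add: dist_of_fun_past)
qed

lemma dist_of_fun_in_dist_plane: "slab_bounded g \<Longrightarrow> dist_of_fun g \<in> dist_plane"
  using lincomb_in_dist_plane[of "{()}" "\<lambda>_. g" "\<lambda>_. 1"] by simp

section \<open>Extension to the cylinder\<close>

text \<open>The mean value inequality on a \<open>closed_segment\<close>, so that the second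
  endpoint may lie on either side of pi below.\<close>

lemma vector_derivative_norm_bound:
  fixes f :: "real \<Rightarrow> 'a::real_normed_vector"
  assumes "\<And>x. x \<in> closed_segment a b \<Longrightarrow> (f has_vector_derivative f' x) (at x)"
    and "\<And>x. x \<in> closed_segment a b \<Longrightarrow> norm (f' x) \<le> B"
  shows "norm (f b - f a) \<le> B * \<bar>b - a\<bar>"
proof -
  have "norm (f b - f a) \<le> B * norm (b - a)"
  proof (rule differentiable_bound[where S = "closed_segment a b" and f' = "\<lambda>x h. h *\<^sub>R f' x"])
    show "(f has_derivative (\<lambda>h. h *\<^sub>R f' x)) (at x within closed_segment a b)" if "x \<in> closed_segment a b" for x
      using assms(1)[OF that] by (auto simp: has_vector_derivative_def intro: has_derivative_at_withinI)
    show "onorm (\<lambda>h. h *\<^sub>R f' x) \<le> B" if "x \<in> closed_segment a b" for x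
      using assms(2)[OF that] order_trans[OF norm_ge_zero assms(2)[OF that]]
      by (intro onorm_bound) (simp_all add: mult.commute[of B] mult_left_mono)
  qed auto
  then show ?thesis by simp
qed

text \<open>The singularity at infinity is removed by subtracting the first-order Taylor polynomial at
  \<open>\<theta> = \<pi>\<close>, with \<open>- sin \<theta>\<close> in the role of \<open>\<theta> - \<pi>\<close>: the remainder is \<open>O(1 / x\<^sup>2)\<close>.\<close>

definition taylor_remainder :: "(real \<times> real \<Rightarrow> complex) \<Rightarrow> real \<times> real \<Rightarrow> complex" where
  "taylor_remainder f = (\<lambda>(t, x). f (t, 2 * arctan x) - f (t, pi)
     + partial_deriv (0, 1) f (t, pi) * of_real (sin (2 * arctan x)))"

definition cylinder_extension :: "(real \<times> real \<Rightarrow> complex) \<Rightarrow> (real \<times> real) functional" where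
  "cylinder_extension g f = (LINT z:future|lborel. g z * taylor_remainder f z)"

lemma basis_snd: "(0, 1) \<in> (Basis :: (real \<times> real) set)"
  by (simp add: Basis_prod_def)

lemma smooth_theta_derivative:
  fixes f :: "real \<times> real \<Rightarrow> complex"
  assumes "smooth f"
  shows "((\<lambda>\<theta>. f (t, \<theta>)) has_vector_derivative partial_deriv (0, 1) f (t, \<theta>)) (at \<theta>)"
proof -
  let ?D = "frechet_derivative f (at (t, \<theta>))"
  have D: "(f has_derivative ?D) (at (t, \<theta>))"
    using smooth_differentiable[OF assms] by (simp add: frechet_derivative_works[symmetric])
  have "((\<lambda>\<theta>. (t, \<theta>)) has_derivative (\<lambda>h. (0, h))) (at \<theta>)"
    by (auto intro!: derivative_eq_intros)
  from diff_chain_at[OF this D] have "((\<lambda>\<theta>. f (t, \<theta>)) has_derivative (\<lambda>h. ?D (0, h))) (at \<theta>)"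
    by (simp add: o_def)
  moreover have "?D (0, h) = h *\<^sub>R partial_deriv (0, 1) f (t, \<theta>)" for h
    using linear_scale[OF has_derivative_linear[OF D], of h "(0, 1)"] by (simp add: partial_deriv_def)
  ultimately show ?thesis by (simp add: has_vector_derivative_def)
qed

text \<open>The left side is the squared distance on the circle from 2 arctan x to the point at
  infinity. For \<bar>x\<bar> > 1 it is (2 arctan (1 / \<bar>x\<bar>))^2, at most 4 / x^2; for
  \<bar>x\<bar> <= 1 the bound 16 suffices, the right side being at least 20.\<close>

lemma arctan_complement_bound: "(pi - 2 * arctan \<bar>x\<bar>)\<^sup>2 \<le> 40 / (1 + x\<^sup>2)"
proof (cases "\<bar>x\<bar> \<le> 1")
  case True
  have "0 \<le> pi - 2 * arctan \<bar>x\<bar>" using arctan_ubound[of "\<bar>x\<bar>"] by simp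
  moreover have "0 \<le> arctan \<bar>x\<bar>" by simp
  then have "pi - 2 * arctan \<bar>x\<bar> \<le> 4" using pi_less_4 by linarith
  ultimately have "(pi - 2 * arctan \<bar>x\<bar>)\<^sup>2 \<le> 4\<^sup>2" by (intro power_mono)
  also have "4\<^sup>2 \<le> 40 / (1 + x\<^sup>2)"
    using True abs_square_le_1[of x] by (simp add: field_simps add_pos_nonneg)
  finally show ?thesis .
next
  case False
  define y where "y = \<bar>x\<bar>"
  have y: "1 < y" "x\<^sup>2 = y\<^sup>2" using False by (auto simp: y_def)
  have "arctan (inverse y) = pi / 2 - arctan y" using y by (intro arctan_inverse) simp
  then have "pi - 2 * arctan y = 2 * arctan (inverse y)" by simp
  moreover have "arctan (inverse y) \<le> inverse y" "0 \<le> arctan (inverse y)"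
    using y by (auto intro: arctan_le_self)
  ultimately have "(pi - 2 * arctan y)\<^sup>2 \<le> (2 * inverse y)\<^sup>2" by (intro power_mono) auto
  also have "\<dots> = 4 / y\<^sup>2" by (simp add: power_mult_distrib power_inverse divide_inverse)
  also have "\<dots> \<le> 40 / (1 + y\<^sup>2)"
  proof -
    have *: "1 \<le> y\<^sup>2" using y by (simp add: one_le_power)
    have "4 / y\<^sup>2 = 40 / (10 * y\<^sup>2)" by simp
    also have "\<dots> \<le> 40 / (1 + y\<^sup>2)" using * by (intro divide_left_mono mult_pos_pos) linarith+
    finally show ?thesis .
  qed
  finally show ?thesis unfolding y by (simp add: y_def)
qed

text \<open>As a function of \<theta> the remainder vanishes to first order at pi, and its second
  derivative is at most twice the norm. Applying the mean value inequality twice gives 2 N (\<theta>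
  - pi)^2, whence 80 = 2 * 40.\<close>

lemma taylor_remainder_bound:
  assumes f: "f \<in> tests_cylinder"
  shows "norm (taylor_remainder f (t, x)) \<le> 80 * Cm_norm 2 f / (1 + x\<^sup>2)"
proof -
  define N where "N = Cm_norm 2 f"
  define f1 where "f1 = partial_deriv (0, 1) f"
  define f2 where "f2 = partial_deriv (0, 1) f1"
  define h where "h \<theta> = f (t, \<theta>) - f (t, pi) + f1 (t, pi) * of_real (sin \<theta>)" for \<theta>
  define h1 where "h1 \<theta> = f1 (t, \<theta>) + f1 (t, pi) * of_real (cos \<theta>)" for \<theta>
  define h2 where "h2 \<theta> = f2 (t, \<theta>) + f1 (t, pi) * of_real (- sin \<theta>)" for \<theta>
  have sm: "smooth f" "smooth f1" and per: "\<And>t \<theta>. f (t, \<theta> + 2 * pi) = f (t, \<theta>)"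
    using f basis_snd by (auto simp: tests_cylinder_def f1_def intro: smooth_partial_deriv)
  have N: "norm (f1 z) \<le> N" "norm (f2 z) \<le> N" for z
    using Cm_norm_upper[OF tests_cylinder_bounded[OF f], of "[(0, 1)]" 2 z]
      Cm_norm_upper[OF tests_cylinder_bounded[OF f], of "[(0, 1), (0, 1)]" 2 z] basis_snd
    by (auto simp: N_def f1_def f2_def)
  have N0: "0 \<le> N" using order_trans[OF norm_ge_zero N(1)] .
  have c: "((\<lambda>\<theta>. complex_of_real (sin \<theta>)) has_vector_derivative of_real (cos \<theta>)) (at \<theta>)"
     "((\<lambda>\<theta>. complex_of_real (cos \<theta>)) has_vector_derivative of_real (- sin \<theta>)) (at \<theta>)" for \<theta>
    by (auto intro!: has_vector_derivative_of_real derivative_eq_intros)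
  have d1: "(h has_vector_derivative h1 \<theta>) (at \<theta>)" for \<theta>
  proof -
    have "(h has_vector_derivative f1 (t, \<theta>) - 0 + f1 (t, pi) * of_real (cos \<theta>)) (at \<theta>)"
      unfolding h_def f1_def
      by (intro has_vector_derivative_add has_vector_derivative_diff has_vector_derivative_const
          has_vector_derivative_mult_right c smooth_theta_derivative sm)
    then show ?thesis by (simp add: h1_def)
  qed
  have d2: "(h1 has_vector_derivative h2 \<theta>) (at \<theta>)" for \<theta>
    unfolding h1_def h2_def f2_def
    by (intro has_vector_derivative_add has_vector_derivative_mult_right c smooth_theta_derivative sm)
  have b2: "norm (h2 \<theta>) \<le> 2 * N" for \<theta>
  proof -
    have "norm (f1 (t, pi)) * norm (complex_of_real (- sin \<theta>)) \<le> N * 1"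
      using N0 by (intro mult_mono N) auto
    then have "norm (h2 \<theta>) \<le> N + N * 1"
      unfolding h2_def by (intro norm_triangle_mono N) (simp only: norm_mult)
    then show ?thesis by simp
  qed
  \<comment> \<open>\<open>h1\<close> vanishes at pi because cos pi = -1; this is why the sine
    enters with a plus sign.\<close>
  have b1: "norm (h1 \<theta>) \<le> 2 * N * \<bar>\<theta> - pi\<bar>" for \<theta>
    using vector_derivative_norm_bound[of pi \<theta> h1 h2 "2 * N"] d2 b2 by (simp add: h1_def)
  have b0: "norm (h \<theta>) \<le> 2 * N * (\<theta> - pi)\<^sup>2" for \<theta>
  proof -
    have "norm (h \<theta> - h pi) \<le> (2 * N * \<bar>\<theta> - pi\<bar>) * \<bar>\<theta> - pi\<bar>"
    proof (rule vector_derivative_norm_bound[OF d1])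
      fix s assume "s \<in> closed_segment pi \<theta>"
      then have "\<bar>s - pi\<bar> \<le> \<bar>\<theta> - pi\<bar>"
        by (auto simp: closed_segment_eq_real_ivl split: if_splits)
      then have "2 * N * \<bar>s - pi\<bar> \<le> 2 * N * \<bar>\<theta> - pi\<bar>" using N0 by (intro mult_left_mono) auto
      then show "norm (h1 s) \<le> 2 * N * \<bar>\<theta> - pi\<bar>" using b1[of s] by linarith
    qed
    moreover have "h pi = 0" by (simp add: h_def)
    ultimately show ?thesis by (simp add: power2_eq_square mult.assoc flip: abs_mult)
  qed
  have "norm (h (2 * arctan x)) \<le> 2 * N * (pi - 2 * arctan \<bar>x\<bar>)\<^sup>2"
  proof (cases "0 \<le> x")
    case True
    then show ?thesis using b0[of "2 * arctan x"] by (simp add: power2_commute)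
  next
    case False
    \<comment> \<open>For x < 0 the angle approaches -pi; a full turn brings it near pi.\<close>
    have "h (2 * arctan x) = h (2 * arctan x + 2 * pi)" by (simp add: h_def per)
    then show ?thesis using b0[of "2 * arctan x + 2 * pi"] False
      by (simp add: arctan_minus abs_of_neg algebra_simps)
  qed
  also have "\<dots> \<le> 2 * N * (40 / (1 + x\<^sup>2))"
    using N0 by (intro mult_left_mono arctan_complement_bound) auto
  finally show ?thesis by (simp add: taylor_remainder_def h_def f1_def N_def)
qed

text \<open>The remainder at (t, x) also involves the point (t, pi), hence a hypothesis on the whole
  circle at time t.\<close>

lemma taylor_remainder_outside:
  assumes "\<And>\<theta>. (t, \<theta>) \<notin> supp f"
  shows "taylor_remainder f (t, x) = 0"
proof -
  have "(t, pi) \<notin> supp (partial_deriv (0, 1) f)" using supp_partial_deriv assms by blast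
  then show ?thesis using assms by (simp add: taylor_remainder_def supp_outside)
qed

lemma taylor_remainder_measurable:
  assumes "f \<in> tests_cylinder"
  shows "taylor_remainder f \<in> borel_measurable borel"
proof -
  have sm: "smooth f" "smooth (partial_deriv (0, 1) f)"
    using assms basis_snd by (auto simp: tests_cylinder_def intro: smooth_partial_deriv)
  have *: "continuous_on UNIV (\<lambda>z. h (p z))" if "smooth h" "continuous_on UNIV p"
    for h :: "real \<times> real \<Rightarrow> complex" and p :: "real \<times> real \<Rightarrow> real \<times> real"
    by (rule continuous_on_compose2[OF smooth_continuous_on[OF that(1)] that(2)]) auto
  show ?thesis
    unfolding taylor_remainder_def case_prod_unfold
    by (intro borel_measurable_continuous_onI continuous_intros * sm)
qed

text \<open>Dominates the remainders supported in the slab up to a factor; its integrability is what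
  the decay 1 / x^2 is for.\<close>

definition slab_weight :: "real \<Rightarrow> real \<times> real \<Rightarrow> real" where
  "slab_weight T = (\<lambda>(t, x). indicator {-T..T} t * (1 / (1 + x\<^sup>2)))"

lemma slab_weight_nonneg: "0 \<le> slab_weight T z"
  by (simp add: slab_weight_def case_prod_unfold)

lemma slab_weight_integrable: "integrable lborel (slab_weight T)"
proof -
  have 1: "integrable lborel (indicator {-T..T} :: real \<Rightarrow> real)"
    using emeasure_compact_finite[of "{-T..T}"] by (intro integrable_real_indicator) auto
  have 2: "integrable lborel (\<lambda>x::real. 1 / (1 + x\<^sup>2))"
    using integrable_inverse_1_plus_square by (simp add: set_integrable_def einterval_def divide_inverse)
  have "integrable (lborel \<Otimes>\<^sub>M lborel) (slab_weight T)"
    unfolding slab_weight_def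
  proof (rule lborel_pair.Fubini_integrable)
    show "(\<lambda>(t, x). indicat_real {-T..T} t * (1 / (1 + x\<^sup>2))) \<in> borel_measurable (lborel \<Otimes>\<^sub>M lborel)"
      using borel_measurable_times[OF measurable_compose[OF measurable_fst borel_measurable_integrable[OF 1]]
          measurable_compose[OF measurable_snd borel_measurable_integrable[OF 2]]]
      unfolding case_prod_unfold .
  qed (use 1 2 in \<open>simp_all add: abs_mult del: times_divide_eq_right\<close>)
  then show ?thesis by (simp add: lborel_prod)
qed

text \<open>The bound is linear in C and stated for one slab, so it applies equally to a difference
  of two functions with C = \<epsilon>. The order 2 comes from the two \<theta>-derivatives in the
  remainder.\<close>

lemma cylinder_extension_bound:
  assumes meas: "g \<in> borel_measurable borel" and C: "\<And>t x. 0 \<le> t \<Longrightarrow> t \<le> T \<Longrightarrow> norm (g (t, x)) \<le> C" "0 \<le> C"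
    and f: "f \<in> tests_cylinder" and supp: "supp f \<subseteq> {-T..T} \<times> UNIV"
  shows "set_integrable lborel future (\<lambda>z. g z * taylor_remainder f z)"
    and "norm (cylinder_extension g f) \<le> C * (80 * (\<integral>z. slab_weight T z \<partial>lborel)) * Cm_norm 2 f"
proof -
  define u where "u = (\<lambda>z. C * 80 * Cm_norm 2 f * slab_weight T z)"
  have N0: "0 \<le> Cm_norm 2 f"
    using Cm_norm_upper[OF tests_cylinder_bounded[OF f], of "[]" 2 undefined] by (auto intro: order_trans[OF norm_ge_zero])
  have int: "integrable lborel u" unfolding u_def by (intro integrable_mult_right slab_weight_integrable)
  have m: "(\<lambda>z. g z * taylor_remainder f z) \<in> borel_measurable borel"
    by (intro borel_measurable_times meas taylor_remainder_measurable f)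
  have "norm (g (t, x) * taylor_remainder f (t, x)) \<le> u (t, x)" if "0 \<le> t" for t x
  proof (cases "t \<le> T")
    case True
    then have "norm (g (t, x) * taylor_remainder f (t, x)) \<le> C * (80 * Cm_norm 2 f / (1 + x\<^sup>2))"
      unfolding norm_mult using C that by (intro mult_mono taylor_remainder_bound f) auto
    then show ?thesis using True that by (simp add: u_def slab_weight_def)
  next
    case False
    then have "taylor_remainder f (t, x) = 0" using supp by (intro taylor_remainder_outside) auto
    then show ?thesis using N0 C(2) slab_weight_nonneg[of T] by (simp add: u_def)
  qed
  moreover have "0 \<le> u z" for z using N0 C(2) slab_weight_nonneg[of T] by (simp add: u_def)
  ultimately have "set_integrable lborel future (\<lambda>z. g z * taylor_remainder f z)"
      "norm (LINT z:future|lborel. g z * taylor_remainder f z) \<le> (\<integral>z. u z \<partial>lborel)"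
    using set_integrable_dominated[OF m int] by blast+
  then show "set_integrable lborel future (\<lambda>z. g z * taylor_remainder f z)"
    "norm (cylinder_extension g f) \<le> C * (80 * (\<integral>z. slab_weight T z \<partial>lborel)) * Cm_norm 2 f"
    by (simp_all add: cylinder_extension_def u_def mult_ac)
qed

lemma tests_cylinder_supp_slab:
  assumes "compact K"
  obtains T :: real where "0 \<le> T" "K \<times> UNIV \<subseteq> {-T..T} \<times> (UNIV :: real set)"
proof -
  obtain T where T: "\<And>t. t \<in> K \<Longrightarrow> \<bar>t\<bar> \<le> T"
    using compact_imp_bounded[OF assms] by (auto simp: bounded_iff)
  show ?thesis by (rule that[of "max 0 T"]) (use T in \<open>fastforce simp: abs_le_iff\<close>)+
qed

lemma slab_bounded_nonneg_bound:
  assumes "slab_bounded g"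
  obtains C where "0 \<le> C" "\<And>t x. 0 \<le> t \<Longrightarrow> t \<le> T \<Longrightarrow> norm (g (t, x)) \<le> C"
proof -
  obtain C where "\<And>t x. 0 \<le> t \<Longrightarrow> t \<le> T \<Longrightarrow> norm (g (t, x)) \<le> C"
    using assms unfolding slab_bounded_def by blast
  then show ?thesis by (intro that[of "\<bar>C\<bar>"]) (auto intro: order_trans[OF _ abs_ge_self])
qed

lemma cylinder_extension_integrable:
  assumes g: "slab_bounded g" and f: "f \<in> tests_cylinder"
  shows "set_integrable lborel future (\<lambda>z. g z * taylor_remainder f z)"
proof -
  obtain K where "compact K" "supp f \<subseteq> K \<times> UNIV" using f by (auto simp: tests_cylinder_def)
  then obtain T where "supp f \<subseteq> {-T..T} \<times> UNIV" using tests_cylinder_supp_slab by (metis order_trans)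
  moreover obtain C where "0 \<le> C" "\<And>t x. 0 \<le> t \<Longrightarrow> t \<le> T \<Longrightarrow> norm (g (t, x)) \<le> C"
    using slab_bounded_nonneg_bound[OF g, of T] by blast
  ultimately show ?thesis
    using g f by (intro cylinder_extension_bound(1)[of g T C]) (auto simp: slab_bounded_def)
qed

lemma cylinder_extension_in_dist_cylinder:
  assumes g: "slab_bounded g"
  shows "cylinder_extension g \<in> dist_cylinder"
  unfolding dist_cylinder_def distributions_def
proof (safe, goal_cases)
  case (1 f h)
  have d: "f differentiable at z" "h differentiable at z" for z
    using 1 by (auto simp: tests_cylinder_def intro: smooth_differentiable)
  have "taylor_remainder (\<lambda>z. f z + h z) = (\<lambda>z. taylor_remainder f z + taylor_remainder h z)"
    by (auto simp: taylor_remainder_def partial_deriv_add d algebra_simps)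
  then show ?case
    unfolding cylinder_extension_def
    using set_integral_add(2)[OF cylinder_extension_integrable[OF g 1(1)] cylinder_extension_integrable[OF g 1(2)]]
    by (simp add: distrib_left)
next
  case (2 c f)
  have d: "f differentiable at z" for z
    using 2 by (auto simp: tests_cylinder_def intro: smooth_differentiable)
  have "taylor_remainder (\<lambda>z. c * f z) = (\<lambda>z. c * taylor_remainder f z)"
    by (auto simp: taylor_remainder_def partial_deriv_cmult d algebra_simps)
  then show ?case
    unfolding cylinder_extension_def by (subst set_integral_mult_right[symmetric]) (simp add: mult.left_commute)
next
  case (3 _ K)
  obtain T where T: "0 \<le> T" "K \<times> UNIV \<subseteq> {-T..T} \<times> (UNIV :: real set)"
    using tests_cylinder_supp_slab[OF 3] by blast
  obtain C where C: "0 \<le> C" "\<And>t x. 0 \<le> t \<Longrightarrow> t \<le> T \<Longrightarrow> norm (g (t, x)) \<le> C"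
    using slab_bounded_nonneg_bound[OF g, of T] by blast
  have "norm (cylinder_extension g f) \<le> C * (80 * (\<integral>z. slab_weight T z \<partial>lborel)) * Cm_norm 2 f"
    if "f \<in> tests_cylinder" "supp f \<subseteq> K \<times> UNIV" for f
    using g C T that by (intro cylinder_extension_bound(2)) (auto simp: slab_bounded_def)
  then show ?case by blast
next
  case (4 f)
  have "(\<lambda>z. indicator future z *\<^sub>R (g z * taylor_remainder f z)) = (\<lambda>z. 0)"
  proof
    fix z :: "real \<times> real"
    obtain t x where z: "z = (t, x)" by (cases z)
    have "taylor_remainder f (t, x) = 0" if "0 \<le> t"
      using 4 that by (intro taylor_remainder_outside) auto
    then show "indicator future z *\<^sub>R (g z * taylor_remainder f z) = 0"
      by (auto simp: z indicator_def)
  qed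
  then show ?case unfolding cylinder_extension_def set_lebesgue_integral_def by (simp only: integral_zero)
qed

text \<open>If the support avoids \<theta> = pi, then f and its \<theta>-derivative vanish there and
  the subtracted polynomial is 0.\<close>

lemma cylinder_extension_extends: "extends_to_cylinder (dist_of_fun g) (cylinder_extension g)"
  unfolding extends_to_cylinder_def
proof (intro ballI impI)
  fix f assume f: "f \<in> tests_cylinder" "supp f \<inter> UNIV \<times> {pi} = {}"
  have "(t, pi) \<notin> supp f" for t using f by auto
  moreover from this have "(t, pi) \<notin> supp (partial_deriv (0, 1) f)" for t using supp_partial_deriv by blast
  ultimately have "taylor_remainder f = (\<lambda>(t, x). f (t, 2 * arctan x))"
    by (auto simp: taylor_remainder_def supp_outside)
  then show "cylinder_extension g f = dist_of_fun g (\<lambda>(t, x). f (t, 2 * arctan x))"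
    by (simp add: cylinder_extension_def dist_of_fun_def)
qed

lemma dist_of_fun_tempered: "slab_bounded g \<Longrightarrow> dist_of_fun g \<in> tempered_x"
  unfolding tempered_x_def
  using dist_of_fun_in_dist_plane cylinder_extension_in_dist_cylinder cylinder_extension_extends by blast

lemma cylinder_extension_diff:
  assumes "slab_bounded g" "slab_bounded h" "f \<in> tests_cylinder"
  shows "cylinder_extension g f - cylinder_extension h f = cylinder_extension (\<lambda>z. g z - h z) f"
  unfolding cylinder_extension_def left_diff_distrib
  by (intro set_integral_diff(2)[symmetric] cylinder_extension_integrable assms)

text \<open>Extensions are not unique, so a coherent choice is needed:
  \<open>cylinder_extension\<close> is additive in the function and controlled by its supremum on a
  slab, hence uniform closeness passes to the extensions.\<close>

lemma converges_tempered_x_uniform: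
  assumes G: "\<And>i. slab_bounded (G i)" and g: "slab_bounded g"
    and lim: "\<And>T \<epsilon>. 0 \<le> T \<Longrightarrow> 0 < \<epsilon> \<Longrightarrow> \<forall>\<^sub>F i in F. \<forall>t x. 0 \<le> t \<longrightarrow> t \<le> T \<longrightarrow> norm (G i (t, x) - g (t, x)) \<le> \<epsilon>"
  shows "converges_tempered_x (\<lambda>i. dist_of_fun (G i)) (dist_of_fun g) F"
  unfolding converges_tempered_x_def
proof (intro conjI allI exI[of _ "\<lambda>i. cylinder_extension (G i)"] exI[of _ "cylinder_extension g"] ballI
    dist_of_fun_tempered cylinder_extension_in_dist_cylinder cylinder_extension_extends G g)
  fix f assume f: "f \<in> tests_cylinder"
  obtain K where "compact K" "supp f \<subseteq> K \<times> UNIV" using f by (auto simp: tests_cylinder_def)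
  then obtain T where T: "0 \<le> T" "supp f \<subseteq> {-T..T} \<times> UNIV" using tests_cylinder_supp_slab by (metis order_trans)
  define c where "c = 80 * (\<integral>z. slab_weight T z \<partial>lborel) * Cm_norm 2 f"
  show "((\<lambda>i. cylinder_extension (G i) f) \<longlongrightarrow> cylinder_extension g f) F"
  proof (rule tendstoI)
    fix e :: real assume e: "0 < e"
    have c1: "0 < \<bar>c\<bar> + 1" by (simp add: add_nonneg_pos)
    \<comment> \<open>The 1 keeps the denominator positive when c = 0, and half of e leaves room for
      the strict inequality.\<close>
    define \<epsilon> where "\<epsilon> = e / 2 / (\<bar>c\<bar> + 1)"
    have \<epsilon>: "0 < \<epsilon>" using e c1 by (simp add: \<epsilon>_def)
    show "\<forall>\<^sub>F i in F. dist (cylinder_extension (G i) f) (cylinder_extension g f) < e"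
      using lim[OF T(1) \<epsilon>]
    proof eventually_elim
      case (elim i)
      have "norm (cylinder_extension (\<lambda>z. G i z - g z) f) \<le> \<epsilon> * (80 * (\<integral>z. slab_weight T z \<partial>lborel)) * Cm_norm 2 f"
        using G[of i] g \<epsilon> elim T(2) f
        by (intro cylinder_extension_bound(2)) (auto simp: slab_bounded_def)
      also have "\<dots> = \<epsilon> * c" by (simp add: c_def)
      also have "\<dots> \<le> \<epsilon> * (\<bar>c\<bar> + 1)" using \<epsilon> by (intro mult_left_mono) auto
      also have "\<dots> = e / 2" unfolding \<epsilon>_def using c1 by (intro nonzero_eq_divide_eq[THEN iffD1]) auto
      also have "\<dots> < e" using e by simp
      finally show ?case by (simp add: dist_norm cylinder_extension_diff G g f)
    qed
  qed
qed

section \<open>Superoscillation of the truncations\<close>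

lemma slab_bounded_evol_trunc:
  assumes "(\<lambda>l. norm (fourier_coeff V l)) summable_on UNIV"
  shows "slab_bounded (evol_trunc V \<alpha> \<omega> K M N)"
  unfolding slab_bounded_def
proof (intro conjI allI)
  show "evol_trunc V \<alpha> \<omega> K M N \<in> borel_measurable borel"
    by (intro borel_measurable_continuous_onI evol_trunc_continuous)
  show "\<exists>C. \<forall>t x. 0 \<le> t \<and> t \<le> T \<longrightarrow> norm (evol_trunc V \<alpha> \<omega> K M N (t, x)) \<le> C" for T
    by (rule exI, intro allI impI, rule evol_trunc_bound[OF assms, of _ T]) auto
qed

lemma slab_bounded_evol:
  assumes "(\<lambda>l. norm (fourier_coeff V l)) summable_on UNIV"
  shows "slab_bounded (evol V \<alpha> \<omega>)"
  unfolding slab_bounded_def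
proof (intro conjI allI)
  show "evol V \<alpha> \<omega> \<in> borel_measurable borel"
    by (rule borel_measurable_LIMSEQ_metric[OF _ evol_trunc_pointwise[OF assms]])
       (intro borel_measurable_continuous_onI evol_trunc_continuous)
  show "\<exists>C. \<forall>t x. 0 \<le> t \<and> t \<le> T \<longrightarrow> norm (evol V \<alpha> \<omega> (t, x)) \<le> C" for T
    by (rule exI, intro allI impI, rule evol_bound[OF assms, of _ T]) auto
qed

lemma evol_trunc_converges_tempered:
  assumes summ: "(\<lambda>l. norm (fourier_coeff V l)) summable_on UNIV"
  shows "converges_tempered_x (\<lambda>(K, M, N). dist_of_fun (evol_trunc V \<alpha> \<omega> K M N))
    (dist_of_fun (evol V \<alpha> \<omega>)) (at_top \<times>\<^sub>F at_top \<times>\<^sub>F at_top)"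
  unfolding case_prod_unfold
proof (rule converges_tempered_x_uniform[OF slab_bounded_evol_trunc[OF summ] slab_bounded_evol[OF summ]])
  fix T \<epsilon> :: real assume "0 \<le> T" "0 < \<epsilon>"
  then obtain P where P: "\<forall>K\<ge>P. \<forall>M\<ge>P. \<forall>N\<ge>P. \<forall>t x. max 0 t \<le> T \<longrightarrow>
      norm (evol_trunc V \<alpha> \<omega> K M N (t, x) - evol V \<alpha> \<omega> (t, x)) \<le> \<epsilon>"
    using evol_trunc_error[OF summ] by blast
  have "\<forall>\<^sub>F i in at_top \<times>\<^sub>F at_top \<times>\<^sub>F at_top. P \<le> fst i \<and> P \<le> fst (snd i) \<and> P \<le> snd (snd i)"
    by (intro eventually_prodI eventually_ge_at_top)
  then show "\<forall>\<^sub>F i in at_top \<times>\<^sub>F at_top \<times>\<^sub>F at_top. \<forall>t x. 0 \<le> t \<longrightarrow> t \<le> T \<longrightarrow>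
      norm (evol_trunc V \<alpha> \<omega> (fst i) (fst (snd i)) (snd (snd i)) (t, x) - evol V \<alpha> \<omega> (t, x)) \<le> \<epsilon>"
    by eventually_elim (use P in auto)
qed

text \<open>With z = (1 - \<omega>) / 2 one has 1 - 2 z = \<omega>, so at each point p the sum is
  the Bernstein operator of the entire function \<open>\<lambda>w. \<Phi> w p\<close>. The sampled
  frequencies lie in [-1, 1] while \<omega> is any real number. The finite sum moves under the
  integral, where a constant on the support of f dominates.\<close>

lemma evol_trunc_superoscillation:
  assumes summ: "(\<lambda>l. norm (fourier_coeff V l)) summable_on UNIV" and f: "f \<in> tests_plane"
  shows "(\<lambda>n. \<Sum>\<nu>\<le>n. of_nat (n choose \<nu>) * of_real ((1 + \<omega>) / 2) ^ (n - \<nu>) * of_real ((1 - \<omega>) / 2) ^ \<nu>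
      * dist_of_fun (evol_trunc V \<alpha> (1 - 2 * real \<nu> / real n) K M N) f)
    \<longlonglongrightarrow> dist_of_fun (evol_trunc V \<alpha> \<omega> K M N) f"
proof -
  define y z where "y = complex_of_real ((1 + \<omega>) / 2)" and "z = complex_of_real ((1 - \<omega>) / 2)"
  define \<rho> where "\<rho> = max 1 (norm z)"
  have yz: "y + z = 1" unfolding y_def z_def of_real_add[symmetric] by (simp add: field_simps)
  have \<rho>: "norm z \<le> \<rho>" "1 \<le> \<rho>" by (auto simp: \<rho>_def)
  have "1 - 2 * z = of_real (1 - 2 * ((1 - \<omega>) / 2))"
    unfolding z_def by (simp only: of_real_diff of_real_mult of_real_1 of_real_numeral)
  also have "1 - 2 * ((1 - \<omega>) / 2) = \<omega>" by (simp add: field_simps)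
  finally have \<omega>: "1 - 2 * z = of_real \<omega>" .
  define \<Phi> where "\<Phi> = evol_analytic V \<alpha> K M N"
  have \<Phi>: "evol_trunc V \<alpha> (1 - 2 * real \<nu> / real n) K M N = \<Phi> (1 - 2 * of_nat \<nu> / of_nat n)" for \<nu> n
    using evol_analytic_of_real[of V \<alpha> K M N "1 - 2 * real \<nu> / real n"] by (simp add: \<Phi>_def)
  have supp: "compact (supp f)" using f by (simp add: tests_plane_def)
  \<comment> \<open>One B serves all points of the support: the disc contains the circle of radius 4
    \<rho> on which \<open>bern_sum_entire_bound\<close> needs it.\<close>
  have "compact ((\<lambda>(w, p). \<Phi> w p) ` (cball 1 (4 * \<rho>) \<times> supp f))"
    unfolding \<Phi>_def
    by (intro compact_continuous_image evol_analytic_continuous compact_Times supp compact_cball)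
  from compact_imp_bounded[OF this] obtain B where
    "\<forall>q\<in>(\<lambda>(w, p). \<Phi> w p) ` (cball 1 (4 * \<rho>) \<times> supp f). norm q \<le> B"
    unfolding bounded_iff by blast
  then have B: "norm (\<Phi> w p) \<le> B" if "w \<in> cball 1 (4 * \<rho>)" "p \<in> supp f" for w p
    using that by (simp add: image_iff)
  obtain N' where N': "\<And>p. norm (f p) \<le> N'"
    using tests_plane_bounded[OF f, of "[]"] by (auto simp: bounded_iff)
  define H where "H n p = bern_sum y z n (\<lambda>\<nu>. \<Phi> (1 - 2 * of_nat \<nu> / of_nat n) p)" for n p
  have hol: "(\<lambda>w. \<Phi> w p) holomorphic_on UNIV" for p
    unfolding \<Phi>_def by (rule evol_analytic_holomorphic)
  have H_bound: "norm (H n p) \<le> 2 * B" if "p \<in> supp f" for n p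
    unfolding H_def using that by (intro bern_sum_entire_bound[OF hol yz \<rho>] B) (auto simp: dist_norm)
  have H_lim: "(\<lambda>n. H n p) \<longlonglongrightarrow> \<Phi> (of_real \<omega>) p" for p
    unfolding H_def \<omega>[symmetric] by (rule bern_sum_entire_limit[OF hol yz])
  have int: "integrable lborel (\<lambda>p. indicator future p *\<^sub>R (evol_trunc V \<alpha> w K M N p * f p))" for w
    using dist_of_fun_integrable[OF slab_bounded_evol_trunc[OF summ] f] by (simp add: set_integrable_def)
  define s where "s n p = (\<Sum>\<nu>\<le>n. of_nat (n choose \<nu>) * y ^ (n - \<nu>) * z ^ \<nu>
      * (indicator future p *\<^sub>R (evol_trunc V \<alpha> (1 - 2 * real \<nu> / real n) K M N p * f p)))" for n p
  have s_eq: "s n p = indicator future p *\<^sub>R (H n p * f p)" for n p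
    unfolding s_def H_def bern_sum_def \<Phi> sum_distrib_right scaleR_sum_right
    by (intro sum.cong) (auto simp: scaleR_conv_of_real mult_ac)
  have s_int: "integrable lborel (s n)" for n
    unfolding s_def by (intro Bochner_Integration.integrable_sum integrable_mult_right int)
  have "(\<Sum>\<nu>\<le>n. of_nat (n choose \<nu>) * y ^ (n - \<nu>) * z ^ \<nu> * dist_of_fun (evol_trunc V \<alpha> (1 - 2 * real \<nu> / real n) K M N) f)
    = (\<integral>p. s n p \<partial>lborel)" for n
    unfolding s_def dist_of_fun_def set_lebesgue_integral_def
    by (subst Bochner_Integration.integral_sum)
       (intro integrable_mult_right int, simp only: integral_mult_right_zero)
  moreover have "(\<lambda>n. \<integral>p. s n p \<partial>lborel) \<longlonglongrightarrow> dist_of_fun (evol_trunc V \<alpha> \<omega> K M N) f"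
    unfolding dist_of_fun_def set_lebesgue_integral_def
  proof (rule integral_dominated_convergence)
    show "integrable lborel (\<lambda>p. indicator (supp f) p *\<^sub>R (2 * B * N'))"
      using emeasure_compact_finite[OF supp] supp by (intro integrable_indicator) (auto simp: borel_compact)
    show "(\<lambda>p. indicator future p *\<^sub>R (evol_trunc V \<alpha> \<omega> K M N p * f p)) \<in> borel_measurable lborel"
      by (rule borel_measurable_integrable[OF int])
    show "s n \<in> borel_measurable lborel" for n by (rule borel_measurable_integrable[OF s_int])
    show "AE p in lborel. (\<lambda>n. s n p) \<longlonglongrightarrow> indicator future p *\<^sub>R (evol_trunc V \<alpha> \<omega> K M N p * f p)"
      unfolding s_eq evol_analytic_of_real[symmetric] \<Phi>_def[symmetric]
      by (intro AE_I2 tendsto_intros H_lim)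
    show "AE p in lborel. norm (s n p) \<le> indicator (supp f) p *\<^sub>R (2 * B * N')" for n
    proof (intro AE_I2)
      fix p
      show "norm (s n p) \<le> indicator (supp f) p *\<^sub>R (2 * B * N')"
      proof (cases "p \<in> supp f")
        case True
        have "norm (H n p * f p) \<le> 2 * B * N'"
          unfolding norm_mult using order_trans[OF norm_ge_zero H_bound[OF True]]
          by (intro mult_mono H_bound True N') auto
        moreover from this have "0 \<le> 2 * B * N'" by (rule order_trans[OF norm_ge_zero])
        ultimately show ?thesis using True by (auto simp: s_eq indicator_def)
      next
        case False
        then show ?thesis by (simp add: s_eq supp_outside)
      qed
    qed
  qed
  ultimately show ?thesis by (simp only: y_def z_def)
qed

theorem theorem4p2:
  fixes \<alpha> :: real and V :: "real \<Rightarrow> real"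
  assumes "\<alpha> = 1 \<or> \<alpha> = -1"
    and "smooth V"
    and "\<forall>x. V (x + 2 * pi) = V x"
  shows "\<forall>\<omega>::real.
     converges_tempered_x
       (\<lambda>(K, M, N). dist_of_fun (evol_trunc V \<alpha> \<omega> K M N))
       (dist_of_fun (evol V \<alpha> \<omega>))
       (at_top \<times>\<^sub>F at_top \<times>\<^sub>F at_top) \<and>
     (\<forall>K\<ge>1. \<forall>M\<ge>1. \<forall>N\<ge>1.
       converges_dist_plane
         (\<lambda>N' f. \<Sum>\<nu> = 0..N'.
            of_nat (N' choose \<nu>) * ((1 + \<omega>) / 2) ^ (N' - \<nu>) * ((1 - \<omega>) / 2) ^ \<nu>
              * dist_of_fun (evol_trunc V \<alpha> (1 - 2 * \<nu> / N') K M N) f)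
         (dist_of_fun (evol_trunc V \<alpha> \<omega> K M N))
         at_top)"
proof (intro allI impI conjI)
  \<comment> \<open>V enters through this summability, which does not involve \<omega> and so serves
    all frequencies 1 - 2 \<nu> / N' at once.\<close>
  have summ: "(\<lambda>l. norm (fourier_coeff V l)) summable_on UNIV"
    using assms(2,3) by (intro fourier_coeff_summable) auto
  fix \<omega> :: real
  show "converges_tempered_x (\<lambda>(K, M, N). dist_of_fun (evol_trunc V \<alpha> \<omega> K M N))
       (dist_of_fun (evol V \<alpha> \<omega>)) (at_top \<times>\<^sub>F at_top \<times>\<^sub>F at_top)"
    by (rule evol_trunc_converges_tempered[OF summ])
  fix K M N :: nat
  note sb = slab_bounded_evol_trunc[OF summ]
  show "converges_dist_plane
         (\<lambda>N' f. \<Sum>\<nu> = 0..N'.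
            of_nat (N' choose \<nu>) * ((1 + \<omega>) / 2) ^ (N' - \<nu>) * ((1 - \<omega>) / 2) ^ \<nu>
              * dist_of_fun (evol_trunc V \<alpha> (1 - 2 * \<nu> / N') K M N) f)
         (dist_of_fun (evol_trunc V \<alpha> \<omega> K M N)) at_top"
    unfolding converges_dist_plane_def
    using evol_trunc_superoscillation[OF summ, of _ \<omega> \<alpha> K M N]
    by (auto intro!: lincomb_in_dist_plane dist_of_fun_in_dist_plane sb simp: atMost_atLeast0)
qed

end
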